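(* There are absolute constants $C,c>0$ such that for every $n\ge 1$, every threshold function $f:\{-1,1\}^n\to\{-1,1\}$ and every $\epsilon\in(0,1)$, there is a threshold function $g(x)=\mathrm{sign}(w\cdot x-\theta)$ on $\{-1,1\}^n$ with $\Pr_x[f(x)\neq g(x)]\le\epsilon$ ($x$ uniform over $\{-1,1\}^n$), where $\theta\in\mathbb{R}$ and $w_1,\dots,w_n$ are all integers with $$|w_i|\le n^{3/2}\cdot 2^{C\epsilon^{-2/3}(\log(2/\epsilon))^{c}}\qquad (i=1,\dots,n).$$
   Context: A threshold function is a function $f:\{-1,1\}^n\to\{-1,1\}$ of the form $f(x)=\mathrm{sign}(w\cdot x-\theta)$ with arbitrary real weights $w_1,\dots,w_n$ and real threshold $\theta$; here $\mathrm{sign}(t)=1$ for $t\ge 0$ and $-1$ for $t<0$. *)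

theory Defs
  imports "HOL-Probability.Probability"
begin

text \<open>Unlike the library's \<^const>\<open>sgn\<close>, this takes the value 1 at 0.\<close>

definition sign :: "real \<Rightarrow> real" where
  "sign t = (if t \<ge> 0 then 1 else - 1)"

text \<open>
  The dimension \<open>n\<close> is a term, not a type, because the constants of the theorem are
  quantified outside it. Points are extensional functions on \<open>{1..n}\<close>, so that each point
  of the cube has exactly one representative and the uniform distribution is the right one.
\<close>

definition cube :: "nat \<Rightarrow> (nat \<Rightarrow> real) set" where
  "cube n = {1..n} \<rightarrow>\<^sub>E {- 1, 1}"

definition halfspace_sign :: "nat \<Rightarrow> (nat \<Rightarrow> real) \<Rightarrow> real \<Rightarrow> (nat \<Rightarrow> real) \<Rightarrow> real" where
  "halfspace_sign n w \<theta> x = sign ((\<Sum>i=1..n. w i * x i) - \<theta>)"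

text \<open>Only the values of \<open>f\<close> on the cube matter.\<close>

definition threshold_function :: "nat \<Rightarrow> ((nat \<Rightarrow> real) \<Rightarrow> real) \<Rightarrow> bool" where
  "threshold_function n f \<longleftrightarrow> (\<exists>w \<theta>. \<forall>x\<in>cube n. f x = halfspace_sign n w \<theta> x)"

end

theory Submission
  imports Defs
begin

text \<open>
  Fix \<open>K \<approx> \<epsilon>\<^sup>-\<^sup>2\<close> and \<open>m \<approx> \<epsilon>\<^sup>-\<^sup>2\<^sup>/\<^sup>3\<close>. Let \<open>w \<cdot> x - \<theta>\<close> represent the function, let \<open>A\<close> be its largest weight
  and \<open>\<beta> = A / (n \<Lambda>)\<close>, where \<open>\<Lambda> = K\<^bsup>O(m)\<^esup>\<close>. If at least \<open>K\<close> weights are \<open>\<ge> \<beta>\<close> in absolute value, or if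
  \<open>3 m\<close> of the absolute weights are pairwise \<open>\<beta>\<close>-separated, then the form rarely takes values below the
  scale \<open>s \<ge> \<beta>\<close> in question: with probability \<open>O(K\<^bsup>-1/2\<^esup>)\<close> by Littlewood and Offord, and with probability
  \<open>O(m\<^bsup>-3/2\<^esup>)\<close> by a theorem of the Erdos--Moser and Sarkozy--Szemeredi type. Both are derived from the fact that
  a monotone event has total influence at most the square root of the number of coordinates. Then rounding the
  weights to multiples of \<open>s (\<epsilon> / n)\<^bsup>1/2\<^esup>\<close> changes few signs, by Chebyshev's inequality.

  Otherwise fewer than \<open>K\<close> weights are large, and up to \<open>\<beta>\<close> they take at most \<open>3 m\<close> absolute values.
  Simultaneous Dirichlet approximation of these values and of \<open>\<theta>\<close> gives an affine form \<open>l\<close> with small integer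
  coefficients that differs by less than 1 from a positive multiple of \<open>w \<cdot> x - \<theta>\<close> on the cube. As \<open>l\<close> is
  integer-valued there, it has the right sign wherever it does not vanish. Subtract a multiple of \<open>l\<close> from
  \<open>w \<cdot> x - \<theta>\<close> so that a coordinate \<open>j\<close> with \<open>l\<^sub>j \<noteq> 0\<close> disappears, approximate the remaining form recursively
  by \<open>g\<close>, and use \<open>H l + g\<close> with \<open>H\<close> larger than all values of \<open>g\<close>. The error event of \<open>g\<close> does not depend on
  \<open>x\<^sub>j\<close>, while \<open>l = 0\<close> fixes \<open>x\<^sub>j\<close> given the other coordinates, so every level of the recursion halves the error
  probability, and \<open>log (1 / \<epsilon>)\<close> levels suffice.
\<close>

section \<open>The cube and influences\<close>

lemma finite_cube [simp]: "finite (cube n)"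
  by (simp add: cube_def finite_PiE)

lemma card_cube: "card (cube n) = 2 ^ n"
  by (simp add: cube_def card_PiE card_insert_if numeral_2_eq_2)

lemma cube_nonempty [simp]: "cube n \<noteq> {}"
  using card_cube[of n] by auto

lemma cube_cases: "x \<in> cube n \<Longrightarrow> i \<in> {1..n} \<Longrightarrow> x i = - 1 \<or> x i = 1"
  by (auto simp: cube_def PiE_def Pi_def)

lemma cube_mult_self: "x \<in> cube n \<Longrightarrow> i \<in> {1..n} \<Longrightarrow> x i * x i = 1"
  using cube_cases[of x n i] by auto

lemma flip_in_cube: "x \<in> cube n \<Longrightarrow> i \<in> {1..n} \<Longrightarrow> x(i := - x i) \<in> cube n"
  by (auto simp: cube_def PiE_def Pi_def extensional_def)

lemma swap_in_cube:
  "x \<in> cube n \<Longrightarrow> i \<in> {1..n} \<Longrightarrow> j \<in> {1..n} \<Longrightarrow> x(i := x j, j := x i) \<in> cube n"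
  by (auto simp: cube_def PiE_def Pi_def extensional_def)

lemma sum_flip:
  assumes "i \<in> {1..n}"
  shows "(\<Sum>x\<in>cube n. g (x(i := - x i))) = (\<Sum>x\<in>cube n. g x)"
  by (rule sum.reindex_bij_witness[where i = "\<lambda>x. x(i := - x i)" and j = "\<lambda>x. x(i := - x i)"])
     (use assms flip_in_cube in auto)

lemma sum_swap:
  assumes "i \<in> {1..n}" "j \<in> {1..n}"
  shows "(\<Sum>x\<in>cube n. g (x(i := x j, j := x i))) = (\<Sum>x\<in>cube n. g x)"
  by (rule sum.reindex_bij_witness[where i = "\<lambda>x. x(i := x j, j := x i)" and j = "\<lambda>x. x(i := x j, j := x i)"])
     (use assms swap_in_cube in \<open>auto simp: fun_upd_twist fun_eq_iff\<close>)

lemma sum_cube_orthogonal: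
  assumes "i \<in> {1..n}" "j \<in> {1..n}"
  shows "(\<Sum>x\<in>cube n. x i * x j) = (if i = j then 2 ^ n else 0)"
proof (cases "i = j")
  case True
  have "(\<Sum>x\<in>cube n. x i * x j) = (\<Sum>x\<in>cube n. 1)"
    using True assms by (intro sum.cong) (auto simp: cube_mult_self)
  then show ?thesis using True by (simp add: card_cube)
next
  case False
  have "(\<Sum>x\<in>cube n. x i * x j) = (\<Sum>x\<in>cube n. (x(i := - x i)) i * (x(i := - x i)) j)"
    using sum_flip[OF assms(1), of "\<lambda>x. x i * x j"] by simp
  also have "\<dots> = - (\<Sum>x\<in>cube n. x i * x j)"
    using False by (simp add: sum_negf)
  finally show ?thesis using False by simp
qed

lemma sum_cube_square:
  assumes "I \<subseteq> {1..n}"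
  shows "(\<Sum>x\<in>cube n. (\<Sum>i\<in>I. e i * x i)\<^sup>2) = 2 ^ n * (\<Sum>i\<in>I. (e i)\<^sup>2)"
proof -
  have fin: "finite I" using assms finite_subset by blast
  have "(\<Sum>x\<in>cube n. (\<Sum>i\<in>I. e i * x i)\<^sup>2)
      = (\<Sum>x\<in>cube n. \<Sum>i\<in>I. \<Sum>j\<in>I. (e i * e j) * (x i * x j))"
    by (simp add: power2_eq_square sum_product algebra_simps)
  also have "\<dots> = (\<Sum>i\<in>I. \<Sum>x\<in>cube n. \<Sum>j\<in>I. (e i * e j) * (x i * x j))"
    by (rule sum.swap)
  also have "\<dots> = (\<Sum>i\<in>I. \<Sum>j\<in>I. \<Sum>x\<in>cube n. (e i * e j) * (x i * x j))"
    by (intro sum.cong refl sum.swap)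
  also have "\<dots> = (\<Sum>i\<in>I. \<Sum>j\<in>I. (e i * e j) * (if i = j then 2 ^ n else 0))"
    using assms by (intro sum.cong refl)
      (simp only: sum_distrib_left[symmetric], subst sum_cube_orthogonal, auto)
  also have "\<dots> = (\<Sum>i\<in>I. 2 ^ n * (e i)\<^sup>2)"
    using fin by (intro sum.cong refl) (simp add: power2_eq_square if_distrib cong: if_cong)
  finally show ?thesis by (simp add: sum_distrib_left)
qed

text \<open>Cauchy-Schwarz against the constant function 1, combined with the orthogonality of the
  coordinates. With coefficients \<plusminus>1 this is the source of the square root of the number
  of coordinates in both anti-concentration bounds.\<close>

lemma sum_cube_abs_le:
  assumes "I \<subseteq> {1..n}"
  shows "(\<Sum>x\<in>cube n. \<bar>\<Sum>i\<in>I. e i * x i\<bar>) \<le> 2 ^ n * sqrt (\<Sum>i\<in>I. (e i)\<^sup>2)"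
proof -
  let ?f = "\<lambda>x. \<Sum>i\<in>I. e i * x i"
  have "(\<Sum>x\<in>cube n. 1 * \<bar>?f x\<bar>) \<le> L2_set (\<lambda>_. 1) (cube n) * L2_set (\<lambda>x. ?f x) (cube n)"
    using L2_set_mult_ineq[of "\<lambda>_. 1" ?f "cube n"] by simp
  also have "\<dots> = sqrt (2 ^ n) * sqrt (2 ^ n * (\<Sum>i\<in>I. (e i)\<^sup>2))"
    by (simp add: L2_set_def sum_cube_square[OF assms] card_cube)
  also have "\<dots> = 2 ^ n * sqrt (\<Sum>i\<in>I. (e i)\<^sup>2)"
    by (simp add: real_sqrt_mult)
  finally show ?thesis by simp
qed

lemma card_cube_filter: "real (card {x \<in> cube n. P x}) = (\<Sum>x\<in>cube n. of_bool (P x))"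
  by (simp add: sum.If_cases Int_def of_bool_def)

section \<open>Affine forms under flips and swaps of coordinates, and the Littlewood-Offord
  bound\<close>

definition affine_form :: "nat \<Rightarrow> (nat \<Rightarrow> real) \<Rightarrow> real \<Rightarrow> (nat \<Rightarrow> real) \<Rightarrow> real" where
  "affine_form n w \<theta> x = (\<Sum>i=1..n. w i * x i) - \<theta>"

lemma affine_form_flip:
  assumes "i \<in> {1..n}"
  shows "affine_form n w \<theta> (x(i := - x i)) = affine_form n w \<theta> x - 2 * w i * x i"
proof -
  have 1: "(\<Sum>k=1..n. w k * (x(i := - x i)) k) = w i * (- x i) + (\<Sum>k\<in>{1..n}-{i}. w k * x k)"
    using assms by (subst sum.remove[of _ i]) auto
  have 2: "(\<Sum>k=1..n. w k * x k) = w i * x i + (\<Sum>k\<in>{1..n}-{i}. w k * x k)"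
    using assms by (subst sum.remove[of _ i]) auto
  show ?thesis unfolding affine_form_def 1 2 by simp
qed

lemma affine_form_swap:
  assumes "i \<in> {1..n}" "j \<in> {1..n}"
  shows "affine_form n w \<theta> (x(i := x j, j := x i)) = affine_form n w \<theta> x + (w i - w j) * (x j - x i)"
proof (cases "i = j")
  case False
  let ?A = "{1..n}-{i}-{j}"
  have 0: "(\<Sum>k=1..n. g k) = g i + (g j + (\<Sum>k\<in>?A. g k))" for g :: "nat \<Rightarrow> real"
    using assms False by (subst sum.remove[of _ i], simp, simp, subst sum.remove[of _ j]) auto
  have "(\<Sum>k\<in>?A. w k * (x(i := x j, j := x i)) k) = (\<Sum>k\<in>?A. w k * x k)"
    by (intro sum.cong) auto
  then show ?thesis unfolding affine_form_def 0 by (simp add: algebra_simps)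
qed (simp add: affine_form_def)

text \<open>An influence argument. The step function \<open>h\<close> is monotone in every
  coordinate after the sign change \<open>\<sigma>\<close>, and each point of the ball is pivotal
  for every coordinate in \<open>J\<close>. The sum of these influences is twice the correlation of
  \<open>h\<close> with a signed sum of coordinates, of order \<open>sqrt (card J)\<close> on
  average.\<close>

theorem littlewood_offord:
  assumes J: "J \<subseteq> {1..n}" and w: "\<And>i. i \<in> J \<Longrightarrow> \<bar>w i\<bar> \<ge> s" and s: "s > 0"
  shows "real (card {x \<in> cube n. \<bar>affine_form n w \<theta> x\<bar> < s}) * real (card J)
           \<le> 2 ^ (n + 1) * sqrt (real (card J))"
proof -
  define y where "y = affine_form n w \<theta>"
  define h :: "(nat \<Rightarrow> real) \<Rightarrow> real" where "h x = of_bool (y x \<ge> s) - of_bool (y x \<le> - s)" for x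
  define \<sigma> where "\<sigma> i = sgn (w i)" for i
  have hbd: "\<bar>h x\<bar> \<le> 1" for x by (auto simp: h_def)
  \<comment> \<open>In the ball \<open>h\<close> vanishes, and a flip moves the form by at least
    \<open>2 * s\<close>, hence to a point where \<open>h\<close> is \<plusminus>1 with the sign
    dictated by the direction of the flip. Elsewhere the right side is nonnegative by
    monotonicity.\<close>
  have step: "of_bool (\<bar>y x\<bar> < s) \<le> \<sigma> i * x i * (h x - h (x(i := - x i)))"
    if x: "x \<in> cube n" and i: "i \<in> J" for x i
  proof -
    have wi: "\<bar>w i\<bar> \<ge> s" using w i by auto
    have fl: "y (x(i := - x i)) = y x - 2 * w i * x i"
      unfolding y_def using i J by (intro affine_form_flip) auto
    have xi: "x i = - 1 \<or> x i = 1" using cube_cases[OF x, of i] i J by blast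
    show ?thesis
      using wi xi s unfolding h_def fl \<sigma>_def
      by (cases "w i > 0"; elim disjE) (auto simp: of_bool_def)
  qed
  have "real (card {x \<in> cube n. \<bar>y x\<bar> < s}) * real (card J)
      = (\<Sum>i\<in>J. \<Sum>x\<in>cube n. of_bool (\<bar>y x\<bar> < s))"
    by (simp add: card_cube_filter mult.commute)
  also have "\<dots> \<le> (\<Sum>i\<in>J. \<Sum>x\<in>cube n. \<sigma> i * x i * (h x - h (x(i := - x i))))"
    using step by (intro sum_mono) auto
  also have "\<dots> = (\<Sum>i\<in>J. \<Sum>x\<in>cube n. 2 * (\<sigma> i * x i * h x))"
  proof (rule sum.cong[OF refl])
    fix i assume i: "i \<in> J"
    \<comment> \<open>The flip permutes the cube and negates \<open>x i\<close>, so the two halves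
      of each influence are equal.\<close>
    have "(\<Sum>x\<in>cube n. \<sigma> i * x i * h (x(i := - x i))) = - (\<Sum>x\<in>cube n. \<sigma> i * x i * h x)"
      using sum_flip[of i n "\<lambda>x. \<sigma> i * x i * h (x(i := - x i))"] i J
      by (simp add: sum_negf subset_eq)
    then show "(\<Sum>x\<in>cube n. \<sigma> i * x i * (h x - h (x(i := - x i)))) = (\<Sum>x\<in>cube n. 2 * (\<sigma> i * x i * h x))"
      by (simp add: right_diff_distrib sum_subtractf sum_distrib_left[symmetric])
  qed
  also have "\<dots> = (\<Sum>x\<in>cube n. 2 * (h x * (\<Sum>i\<in>J. \<sigma> i * x i)))"
    by (subst sum.swap) (simp add: sum_distrib_left mult_ac)
  also have "\<dots> \<le> (\<Sum>x\<in>cube n. 2 * \<bar>\<Sum>i\<in>J. \<sigma> i * x i\<bar>)"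
  proof (intro sum_mono mult_left_mono)
    fix x
    have "h x * (\<Sum>i\<in>J. \<sigma> i * x i) \<le> \<bar>h x\<bar> * \<bar>\<Sum>i\<in>J. \<sigma> i * x i\<bar>"
      by (metis abs_ge_self abs_mult)
    also have "\<dots> \<le> 1 * \<bar>\<Sum>i\<in>J. \<sigma> i * x i\<bar>" by (intro mult_right_mono hbd) auto
    finally show "h x * (\<Sum>i\<in>J. \<sigma> i * x i) \<le> \<bar>\<Sum>i\<in>J. \<sigma> i * x i\<bar>" by simp
  qed simp
  also have "\<dots> \<le> 2 * (2 ^ n * sqrt (\<Sum>i\<in>J. (\<sigma> i)\<^sup>2))"
    unfolding sum_distrib_left[symmetric] by (intro mult_left_mono sum_cube_abs_le J) auto
  also have "\<dots> \<le> 2 * (2 ^ n * sqrt (real (card J)))"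
    using sum_bounded_above[of J "\<lambda>i. (\<sigma> i)\<^sup>2" 1]
    by (intro mult_left_mono) (auto simp: \<sigma>_def sgn_if power2_eq_square)
  finally show ?thesis by (simp add: y_def)
qed

section \<open>A lower tail bound for the number of coordinates with a prescribed sign\<close>

lemma sum_cube_power_card:
  assumes I: "I \<subseteq> {1..n}" and v: "v \<in> {- 1, 1}"
  shows "(\<Sum>x\<in>cube n. (1 / 2) ^ card {i \<in> I. x i = v}) = 2 ^ n * (3 / 4 :: real) ^ card I"
proof -
  have fin: "finite I" using I finite_subset by blast
  let ?g = "\<lambda>i t. if i \<in> I \<and> t = v then 1 / 2 else (1 :: real)"
  have "(\<Sum>x\<in>cube n. (1 / 2) ^ card {i \<in> I. x i = v}) = (\<Sum>x\<in>cube n. \<Prod>i\<in>{1..n}. ?g i (x i))"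
  proof (intro sum.cong refl)
    fix x :: "nat \<Rightarrow> real"
    have "{i \<in> {1..n}. i \<in> I \<and> x i = v} = {i \<in> I. x i = v}" using I by auto
    then show "(1 / 2) ^ card {i \<in> I. x i = v} = (\<Prod>i\<in>{1..n}. ?g i (x i))"
      by (simp add: prod.If_cases Int_def)
  qed
  also have "\<dots> = (\<Prod>i\<in>{1..n}. \<Sum>t\<in>{- 1, 1}. ?g i t)"
    unfolding cube_def by (rule prod_sum_PiE[symmetric]) auto
  also have "\<dots> = (\<Prod>i\<in>{1..n}. if i \<in> I then 3 / 2 else 2)"
    using v by (intro prod.cong) auto
  also have "\<dots> = (3 / 2) ^ card I * 2 ^ card ({1..n} - I)"
    using I by (simp add: prod.If_cases Int_absorb1 Diff_eq)
  also have "\<dots> = 2 ^ n * (3 / 4) ^ card I"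
  proof -
    have le: "card I \<le> n" using card_mono[OF _ I] by simp
    have c: "card ({1..n} - I) = n - card I" using card_Diff_subset[OF fin I] by simp
    have "(2::real) ^ n = 2 ^ card I * 2 ^ (n - card I)"
      using le by (simp flip: power_add)
    moreover have "(3 / 2 :: real) ^ card I = 2 ^ card I * (3 / 4) ^ card I"
      by (simp flip: power_mult_distrib)
    ultimately show ?thesis unfolding c by simp
  qed
  finally show ?thesis .
qed

text \<open>Markov's inequality for the exponential moment \<open>(1 / 2) ^ count\<close>, whose
  mean is \<open>(3 / 4) ^ m\<close> by independence. The exponential decay is weakened to a
  quadratic one, which is still smaller than \<open>m powr (- 3 / 2)\<close>.\<close>

lemma card_few_coordinates:
  assumes I: "I \<subseteq> {1..n}" and v: "v \<in> {- 1, 1}" and m: "card I = m" "m > 0"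
  shows "real (card {x \<in> cube n. 4 * card {i \<in> I. x i = v} < m}) \<le> 2 ^ n * (361 / real m ^ 2)"
proof -
  let ?c = "\<lambda>x :: nat \<Rightarrow> real. card {i \<in> I. x i = v}"
  \<comment> \<open>With \<open>u ^ 4 = 2\<close>, a count below \<open>m / 4\<close> gives
    \<open>2 ^ count \<le> u ^ m\<close>.\<close>
  define u :: real where "u = 2 powr (1 / 4)"
  have u4: "u ^ 4 = 2" by (simp add: u_def powr_power)
  have u1: "u \<ge> 1" by (simp add: u_def ge_one_powr_ge_zero)
  have u2: "u \<le> 6 / 5"
  proof (rule ccontr)
    assume "\<not> u \<le> 6 / 5"
    then have "(6 / 5) ^ 4 < u ^ 4" by (intro power_strict_mono) auto
    then show False using u4 by (simp add: power4_eq_xxxx)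
  qed
  have ind: "of_bool (4 * ?c x < m) \<le> u ^ m * (1 / 2) ^ ?c x" for x
  proof (cases "4 * ?c x < m")
    case True
    have "2 ^ ?c x = u ^ (4 * ?c x)" by (simp add: power_mult u4)
    also have "\<dots> \<le> u ^ m" using True u1 by (intro power_increasing) auto
    finally show ?thesis using True by (simp add: field_simps)
  qed (use u1 in auto)
  have "real (card {x \<in> cube n. 4 * ?c x < m}) \<le> (\<Sum>x\<in>cube n. u ^ m * (1 / 2) ^ ?c x)"
    unfolding card_cube_filter by (intro sum_mono ind)
  also have "\<dots> = 2 ^ n * (u * (3 / 4)) ^ m"
    by (simp only: sum_distrib_left[symmetric] sum_cube_power_card[OF I v] m power_mult_distrib) simp
  \<comment> \<open>From \<open>u \<le> 6 / 5\<close> the base is at most 9/10, just below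
    \<open>(19 / 20)\<^sup>2\<close>. The square is kept so that one linear Bernoulli bound yields
    quadratic decay.\<close>
  also have "\<dots> \<le> 2 ^ n * ((19 / 20) ^ 2) ^ m"
    using u2 u1 by (intro mult_left_mono power_mono) (auto simp: power2_eq_square)
  also have "\<dots> = 2 ^ n * ((19 / 20) ^ m)\<^sup>2" by (simp add: power_mult[symmetric] mult.commute)
  also have "\<dots> \<le> 2 ^ n * (19 / real m)\<^sup>2"
  proof (intro mult_left_mono power_mono)
    have "1 + real m * (1 / 19) \<le> (1 + 1 / 19 :: real) ^ m" by (intro Bernoulli_inequality) auto
    then have "real m / 19 \<le> (20 / 19) ^ m" by simp
    then have "real m / 19 * (19 / 20) ^ m \<le> (20 / 19) ^ m * (19 / 20) ^ m"
      by (intro mult_right_mono) auto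
    also have "\<dots> = 1" by (simp flip: power_mult_distrib)
    finally show "(19 / 20) ^ m \<le> 19 / real m" using m by (simp add: field_simps)
  qed auto
  also have "\<dots> = 2 ^ n * (361 / real m ^ 2)" by (simp add: power_divide)
  finally show ?thesis .
qed

text \<open>The influence argument with swaps in place of flips. Since \<open>w l \<le> w r\<close>,
  moving a 1 from \<open>l\<close> to \<open>r\<close> cannot lower the form, so crossings of a pair
  are controlled by the correlation of \<open>f\<close> with \<open>x r - x l\<close>. Over all
  \<open>m\<^sup>2\<close> pairs these differences add up to \<open>m\<close> times one signed sum
  of \<open>2 * m\<close> coordinates, of average size at most \<open>sqrt (2 * m)\<close>.\<close>

lemma separated_crossings:
  assumes sub: "L \<subseteq> {1..n}" "R \<subseteq> {1..n}" and disj: "L \<inter> R = {}"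
    and c: "card L = m" "card R = m"
    and ord: "\<And>l r. l \<in> L \<Longrightarrow> r \<in> R \<Longrightarrow> w l \<le> w r"
  shows "(\<Sum>l\<in>L. \<Sum>r\<in>R. \<Sum>x\<in>cube n. of_bool (x l = 1 \<and> x r = - 1 \<and> affine_form n w \<theta> x < 0 \<and>
             affine_form n w \<theta> (x(l := x r, r := x l)) \<ge> 0))
           \<le> 2 ^ n * (real m * sqrt (real m))"
proof -
  define y where "y = affine_form n w \<theta>"
  define f :: "(nat \<Rightarrow> real) \<Rightarrow> real" where "f x = of_bool (y x \<ge> 0)" for x
  have fin: "finite L" "finite R" using sub finite_subset by blast+
  let ?cr = "\<lambda>l r x. x l = 1 \<and> x r = - 1 \<and> y x < 0 \<and> y (x(l := x r, r := x l)) \<ge> 0"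
  have pair: "2 * (\<Sum>x\<in>cube n. of_bool (?cr l r x)) \<le> (\<Sum>x\<in>cube n. f x * (x r - x l))"
    if l: "l \<in> L" and r: "r \<in> R" for l r
  proof -
    have lr: "l \<in> {1..n}" "r \<in> {1..n}" "l \<noteq> r" using l r sub disj by auto
    define t where "t x = x(l := x r, r := x l)" for x :: "nat \<Rightarrow> real"
    have sw: "(\<Sum>x\<in>cube n. g (t x)) = (\<Sum>x\<in>cube n. g x)" for g :: "_ \<Rightarrow> real"
      unfolding t_def using sum_swap lr by auto
    have tt: "t (t x) = x" for x using lr by (auto simp: t_def)
    have yt: "y (t x) = y x + (w l - w r) * (x r - x l)" for x
      unfolding y_def t_def by (rule affine_form_swap) (use lr in auto)
    \<comment> \<open>If \<open>x\<close> or \<open>t x\<close> is a crossing, then \<open>f\<close>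
      changes by 1 and \<open>x r - x l\<close> is \<plusminus>2 with matching sign; otherwise the
      product is nonnegative by monotonicity.\<close>
    have step: "2 * (of_bool (?cr l r x) + of_bool (?cr l r (t x))) \<le> (f x - f (t x)) * (x r - x l)"
      if x: "x \<in> cube n" for x
    proof -
      have xl: "x l = - 1 \<or> x l = 1" and xr: "x r = - 1 \<or> x r = 1"
        using cube_cases[OF x] lr by auto
      have tl: "t x l = x r" "t x r = x l" using lr by (auto simp: t_def)
      have eq: "?cr l r x \<longleftrightarrow> x l = 1 \<and> x r = - 1 \<and> y x < 0 \<and> y (t x) \<ge> 0"
        "?cr l r (t x) \<longleftrightarrow> x r = 1 \<and> x l = - 1 \<and> y (t x) < 0 \<and> y x \<ge> 0"
        using tt[of x] by (simp_all add: t_def lr lr(3)[symmetric])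
      have le: "w l \<le> w r" using ord l r by auto
      show ?thesis
        using xl xr le yt[of x]
        unfolding eq f_def by (elim disjE) (auto simp: of_bool_def)
    qed
    have "4 * (\<Sum>x\<in>cube n. of_bool (?cr l r x) :: real)
        = (\<Sum>x\<in>cube n. 2 * (of_bool (?cr l r x) + of_bool (?cr l r (t x))))"
      using sw[of "\<lambda>x. of_bool (?cr l r x)"]
      by (simp only: sum_distrib_left[symmetric] sum.distrib) simp
    also have "\<dots> \<le> (\<Sum>x\<in>cube n. (f x - f (t x)) * (x r - x l))"
      by (intro sum_mono step)
    also have "\<dots> = (\<Sum>x\<in>cube n. f x * (x r - x l)) - (\<Sum>x\<in>cube n. f (t x) * (x r - x l))"
      by (simp add: sum_subtractf left_diff_distrib)
    also have "(\<Sum>x\<in>cube n. f (t x) * (x r - x l)) = - (\<Sum>x\<in>cube n. f x * (x r - x l))"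
    proof -
      have "(\<Sum>x\<in>cube n. f (t x) * (x r - x l)) = (\<Sum>x\<in>cube n. f (t (t x)) * (t x r - t x l))"
        by (rule sw[symmetric])
      also have "\<dots> = (\<Sum>x\<in>cube n. - (f x * (x r - x l)))"
        unfolding tt using lr by (intro sum.cong refl) (auto simp: t_def algebra_simps)
      finally show ?thesis by (simp add: sum_negf)
    qed
    finally show ?thesis by linarith
  qed
  let ?e = "\<lambda>i. if i \<in> R then 1 else (- 1 :: real)"
  have "2 * (\<Sum>l\<in>L. \<Sum>r\<in>R. \<Sum>x\<in>cube n. of_bool (?cr l r x))
      \<le> (\<Sum>l\<in>L. \<Sum>r\<in>R. \<Sum>x\<in>cube n. f x * (x r - x l))"
    unfolding sum_distrib_left by (rule sum_mono, rule sum_mono, rule pair[unfolded sum_distrib_left])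
  also have "\<dots> = (\<Sum>l\<in>L. \<Sum>x\<in>cube n. \<Sum>r\<in>R. f x * (x r - x l))"
    by (intro sum.cong refl sum.swap)
  also have "\<dots> = (\<Sum>x\<in>cube n. \<Sum>l\<in>L. \<Sum>r\<in>R. f x * (x r - x l))"
    by (rule sum.swap)
  also have "\<dots> = (\<Sum>x\<in>cube n. f x * (real m * (\<Sum>i\<in>L \<union> R. ?e i * x i)))"
  proof (intro sum.cong refl)
    fix x :: "nat \<Rightarrow> real"
    have "(\<Sum>i\<in>L \<union> R. ?e i * x i) = (\<Sum>i\<in>L. ?e i * x i) + (\<Sum>i\<in>R. ?e i * x i)"
      using fin disj by (intro sum.union_disjoint) auto
    also have "(\<Sum>i\<in>L. ?e i * x i) = - (\<Sum>i\<in>L. x i)"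
      using disj by (subst sum_negf[symmetric], intro sum.cong) auto
    finally have "(\<Sum>i\<in>L \<union> R. ?e i * x i) = (\<Sum>i\<in>R. x i) - (\<Sum>i\<in>L. x i)" by simp
    moreover have "(\<Sum>l\<in>L. \<Sum>r\<in>R. f x * (x r - x l)) = f x * (real m * ((\<Sum>i\<in>R. x i) - (\<Sum>i\<in>L. x i)))"
      by (simp add: sum_distrib_left[symmetric] sum_subtractf c right_diff_distrib)
    ultimately show "(\<Sum>l\<in>L. \<Sum>r\<in>R. f x * (x r - x l)) = f x * (real m * (\<Sum>i\<in>L \<union> R. ?e i * x i))"
      by simp
  qed
  also have "\<dots> \<le> (\<Sum>x\<in>cube n. real m * \<bar>\<Sum>i\<in>L \<union> R. ?e i * x i\<bar>)"
    by (intro sum_mono) (auto simp: f_def of_bool_def intro!: mult_left_mono)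
  also have "\<dots> \<le> real m * (2 ^ n * sqrt (\<Sum>i\<in>L \<union> R. (?e i)\<^sup>2))"
    unfolding sum_distrib_left[symmetric] using sub by (intro mult_left_mono sum_cube_abs_le) auto
  also have "(\<Sum>i\<in>L \<union> R. (?e i)\<^sup>2) = 2 * real m"
  proof -
    have "(?e i)\<^sup>2 = 1" for i by simp
    then show ?thesis using fin disj c by (simp add: card_Un_disjoint del: power2_eq_1_iff)
  qed
  \<comment> \<open>The factor \<open>sqrt 2\<close> is rounded up to 2, which cancels the 2 on the
    left of the chain.\<close>
  also have "real m * (2 ^ n * sqrt (2 * real m)) \<le> real m * (2 ^ n * (2 * sqrt (real m)))"
    using real_sqrt_le_mono[of 2 4]
    by (intro mult_left_mono) (auto simp: real_sqrt_mult intro!: mult_right_mono)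
  also have "\<dots> = 2 * (2 ^ n * (real m * sqrt (real m)))" by (simp add: mult_ac)
  finally show ?thesis unfolding y_def by linarith
qed

section \<open>Anti-concentration for separated weights\<close>

text \<open>
  For \<open>x\<close> in the ball with \<open>x\<^sub>l = -1\<close>, \<open>x\<^sub>p = 1\<close>, \<open>x\<^sub>r = -1\<close>, exchanging coordinates \<open>l\<close> and \<open>p\<close> gives a point where
  the form is negative but becomes nonnegative when \<open>l\<close> and \<open>r\<close> are exchanged. As the weights in \<open>M\<close> are
  separated, this point together with \<open>l\<close> and \<open>r\<close> determines \<open>p\<close>. So a typical point of the ball, which has of
  order \<open>m\<^sup>3\<close> such triples, competes for only \<open>m\<^bsup>3/2\<^esup> 2\<^sup>n\<close> crossings.
\<close>

lemma card_blocks_small_ball: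
  assumes sub: "L \<subseteq> {1..n}" "M \<subseteq> {1..n}" "R \<subseteq> {1..n}"
    and disj: "L \<inter> M = {}" "M \<inter> R = {}" "L \<inter> R = {}"
    and c: "card L = m" "card M = m" "card R = m" and m: "m > 0" and s: "s > 0"
    and LM: "\<And>l p. l \<in> L \<Longrightarrow> p \<in> M \<Longrightarrow> w l + s \<le> w p"
    and MR: "\<And>p r. p \<in> M \<Longrightarrow> r \<in> R \<Longrightarrow> w p + s \<le> w r"
    and MM: "\<And>p q. p \<in> M \<Longrightarrow> q \<in> M \<Longrightarrow> p \<noteq> q \<Longrightarrow> \<bar>w p - w q\<bar> \<ge> s"
  shows "real (card {x \<in> cube n. \<bar>affine_form n w \<theta> x\<bar> < s}) \<le> 2 ^ n * (1147 / (real m * sqrt (real m)))"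
proof -
  define y where "y = affine_form n w \<theta>"
  have fin: "finite L" "finite M" "finite R" using sub finite_subset by blast+
  define G :: "nat \<Rightarrow> nat \<Rightarrow> nat \<Rightarrow> (nat \<Rightarrow> real) \<Rightarrow> real"
    where "G l p r x = of_bool (\<bar>y x\<bar> < s \<and> x l = - 1 \<and> x p = 1 \<and> x r = - 1)" for l p r x
  let ?cr = "\<lambda>l r x. x l = 1 \<and> x r = - 1 \<and> y x < 0 \<and> y (x(l := x r, r := x l)) \<ge> 0"
  have unique: "(\<Sum>p\<in>M. G l p r (x(l := x p, p := x l))) \<le> of_bool (?cr l r x)"
    if l: "l \<in> L" and r: "r \<in> R" for l r x
  proof -
    let ?P = "\<lambda>p. \<bar>y (x(l := x p, p := x l))\<bar> < s \<and> x p = - 1 \<and> x l = 1 \<and> x r = - 1"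
    have ysw: "y (x(i := x j, j := x i)) = y x + (w i - w j) * (x j - x i)"
      if "i \<in> {1..n}" "j \<in> {1..n}" for i j
      unfolding y_def by (rule affine_form_swap) (use that in auto)
    have lr: "l \<in> {1..n}" "r \<in> {1..n}" "l \<noteq> r" using l r sub disj by auto
    have "(\<Sum>p\<in>M. G l p r (x(l := x p, p := x l))) = (\<Sum>p\<in>M. of_bool (?P p))"
    proof (rule sum.cong[OF refl])
      fix p assume p: "p \<in> M"
      then have "l \<noteq> p" "r \<noteq> p" using l r disj by auto
      then show "G l p r (x(l := x p, p := x l)) = of_bool (?P p)"
        using lr by (auto simp: G_def)
    qed
    also have "\<dots> = real (card {p \<in> M. ?P p})"
      using fin by (simp add: sum.If_cases Int_def of_bool_def)
    also have "\<dots> \<le> of_bool (?cr l r x)"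
    proof (cases "{p \<in> M. ?P p} = {}")
      case False
      then obtain p where p: "p \<in> M" "?P p" by auto
      have yp: "y (x(l := x q, q := x l)) = y x + 2 * (w q - w l)" if "q \<in> M" "?P q" for q
      proof -
        have "q \<in> {1..n}" using that sub by auto
        then show ?thesis using ysw[of l q] that lr by (simp add: algebra_simps)
      qed
      have "q = p" if q: "q \<in> M" "?P q" for q
      proof (rule ccontr)
        assume "q \<noteq> p"
        \<comment> \<open>Both exchanged points have values in the open interval from
          \<open>- s\<close> to \<open>s\<close>, but these values differ by
          \<open>2 * \<bar>w q - w p\<bar> \<ge> 2 * s\<close>.\<close>
        then have "\<bar>w q - w p\<bar> \<ge> s" using MM q p by auto
        then show False using yp[OF p] yp[OF q] p(2)[THEN conjunct1] q(2)[THEN conjunct1] by argo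
      qed
      then have one: "{p \<in> M. ?P p} = {p}" using p by blast
      \<comment> \<open>Undoing the exchange lowers the form by at least \<open>2 * s\<close> from a
        value below \<open>s\<close>; exchanging \<open>l\<close> with \<open>r\<close> instead of
        \<open>p\<close> raises it by at least \<open>2 * s\<close> from a value above
        \<open>- s\<close>.\<close>
      have "y x < 0" using yp[OF p] p(2)[THEN conjunct1] LM[OF l p(1)] s by argo
      moreover have "y (x(l := x r, r := x l)) = y x + 2 * (w r - w l)"
        using ysw[OF lr(1,2)] p by (simp add: algebra_simps)
      then have "y (x(l := x r, r := x l)) \<ge> 0"
        using yp[OF p] p(2)[THEN conjunct1] MR[OF p(1) r] s by argo
      ultimately have "?cr l r x" using p by blast
      then have cr: "of_bool (?cr l r x) = (1 :: real)" by (rule of_bool_eq_1_iff[THEN iffD2])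
      show ?thesis unfolding one cr by simp
    next
      case True
      show ?thesis unfolding True by (simp add: of_bool_def)
    qed
    finally show ?thesis .
  qed
  have total: "(\<Sum>x\<in>cube n. \<Sum>l\<in>L. \<Sum>r\<in>R. \<Sum>p\<in>M. G l p r x) \<le> 2 ^ n * (real m * sqrt (real m))"
  proof -
    have "(\<Sum>x\<in>cube n. \<Sum>l\<in>L. \<Sum>r\<in>R. \<Sum>p\<in>M. G l p r x)
        = (\<Sum>l\<in>L. \<Sum>x\<in>cube n. \<Sum>r\<in>R. \<Sum>p\<in>M. G l p r x)"
      by (rule sum.swap)
    also have "\<dots> = (\<Sum>l\<in>L. \<Sum>r\<in>R. \<Sum>x\<in>cube n. \<Sum>p\<in>M. G l p r x)"
      by (rule sum.cong[OF refl], rule sum.swap)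
    also have "\<dots> = (\<Sum>l\<in>L. \<Sum>r\<in>R. \<Sum>p\<in>M. \<Sum>x\<in>cube n. G l p r x)"
      by (rule sum.cong[OF refl], rule sum.cong[OF refl], rule sum.swap)
    \<comment> \<open>For fixed \<open>l\<close>, \<open>p\<close>, \<open>r\<close> the exchange
      permutes the cube. Evaluating at exchanged points lets the sum over \<open>p\<close> collapse
      by \<open>unique\<close>.\<close>
    also have "\<dots> = (\<Sum>l\<in>L. \<Sum>r\<in>R. \<Sum>p\<in>M. \<Sum>x\<in>cube n. G l p r (x(l := x p, p := x l)))"
      by (rule sum.cong[OF refl], rule sum.cong[OF refl], rule sum.cong[OF refl], rule sum_swap[symmetric])
         (use sub in auto)
    also have "\<dots> = (\<Sum>l\<in>L. \<Sum>r\<in>R. \<Sum>x\<in>cube n. \<Sum>p\<in>M. G l p r (x(l := x p, p := x l)))"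
      by (rule sum.cong[OF refl], rule sum.cong[OF refl], rule sum.swap)
    also have "\<dots> \<le> (\<Sum>l\<in>L. \<Sum>r\<in>R. \<Sum>x\<in>cube n. of_bool (?cr l r x))"
      by (intro sum_mono unique)
    also have "\<dots> \<le> 2 ^ n * (real m * sqrt (real m))"
      unfolding y_def
    proof (rule separated_crossings)
      fix l r assume lr: "l \<in> L" "r \<in> R"
      obtain p where "p \<in> M" using c m by fastforce
      then show "w l \<le> w r" using LM[OF lr(1)] MR[OF _ lr(2)] s by fastforce
    qed (use sub disj c in auto)
    finally show ?thesis .
  qed
  let ?N = "\<lambda>I v x. card {i \<in> I. x i = v}"
  define few where "few I v = {x \<in> cube n. 4 * ?N I v x < m}" for I and v :: real
  \<comment> \<open>The typical points of the ball: each block has at least \<open>m / 4\<close>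
    coordinates of the sign required by \<open>G\<close>, hence at least \<open>(m / 4) ^ 3\<close>
    triples.\<close>
  define T where "T = {x \<in> cube n. \<bar>y x\<bar> < s} - (few L (-1) \<union> few M 1 \<union> few R (-1))"
  have many: "(real m / 4) ^ 3 \<le> (\<Sum>l\<in>L. \<Sum>r\<in>R. \<Sum>p\<in>M. G l p r x)" if x: "x \<in> T" for x
  proof -
    have N: "real m / 4 \<le> real (?N L (-1) x)" "real m / 4 \<le> real (?N R (-1) x)"
      "real m / 4 \<le> real (?N M 1 x)"
      using x unfolding T_def few_def by auto
    have "(real m / 4) ^ 3 \<le> real (?N L (-1) x) * (real (?N R (-1) x) * real (?N M 1 x))"
      unfolding power3_eq_cube mult.assoc using N by (intro mult_mono) auto
    also have "\<dots> = (\<Sum>l\<in>L. of_bool (x l = - 1)) * ((\<Sum>r\<in>R. of_bool (x r = - 1)) * (\<Sum>p\<in>M. of_bool (x p = 1)))"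
      using fin by (simp add: sum.If_cases Int_def of_bool_def)
    also have "\<dots> = (\<Sum>l\<in>L. \<Sum>r\<in>R. \<Sum>p\<in>M. of_bool (x l = - 1) * (of_bool (x r = - 1) * of_bool (x p = 1)))"
      unfolding sum_product unfolding sum_distrib_left ..
    also have "\<dots> = (\<Sum>l\<in>L. \<Sum>r\<in>R. \<Sum>p\<in>M. G l p r x)"
      using x by (intro sum.cong) (auto simp: G_def T_def of_bool_def)
    finally show ?thesis .
  qed
  have "real (card T) * (real m / 4) ^ 3 = (\<Sum>x\<in>T. (real m / 4) ^ 3)" by simp
  also have "\<dots> \<le> (\<Sum>x\<in>T. \<Sum>l\<in>L. \<Sum>r\<in>R. \<Sum>p\<in>M. G l p r x)" by (intro sum_mono many)
  also have "\<dots> \<le> (\<Sum>x\<in>cube n. \<Sum>l\<in>L. \<Sum>r\<in>R. \<Sum>p\<in>M. G l p r x)"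
    by (intro sum_mono2) (auto simp: T_def G_def intro!: sum_nonneg)
  also have "\<dots> \<le> 2 ^ n * (real m * sqrt (real m))" by (rule total)
  finally have T1: "real (card T) * (real m / 4) ^ 3 \<le> 2 ^ n * (real m * sqrt (real m))" .
  define q where "q = sqrt (real m)"
  have q: "q \<ge> 1" "q\<^sup>2 = real m" using m by (auto simp: q_def)
  have q3: "real m * sqrt (real m) = q ^ 3" using q by (simp add: q_def power3_eq_cube)
  have "(real m / 4) ^ 3 = q ^ 3 / 64 * q ^ 3"
    by (simp add: q(2)[symmetric] power_divide power_mult[symmetric] power_add[symmetric])
  then have "(real (card T) * (q ^ 3 / 64)) * q ^ 3 \<le> 2 ^ n * q ^ 3"
    using T1 unfolding q3 by (simp only: mult.assoc)
  then have "real (card T) * (q ^ 3 / 64) \<le> 2 ^ n"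
    by (rule mult_right_le_imp_le) (use q in simp)
  then have T2: "real (card T) \<le> 2 ^ n * (64 / q ^ 3)" using q by (simp add: field_simps)
  have few: "real (card (few I v)) \<le> 2 ^ n * (361 / q ^ 3)"
    if "I \<subseteq> {1..n}" "card I = m" "v \<in> {-1, 1}" for I v
  proof -
    have "real (card (few I v)) \<le> 2 ^ n * (361 / real m ^ 2)"
      unfolding few_def by (rule card_few_coordinates) (use that m in auto)
    also have "\<dots> \<le> 2 ^ n * (361 / q ^ 3)"
    proof (intro mult_left_mono divide_left_mono)
      have "q ^ 3 \<le> q ^ 4" using q by (intro power_increasing) auto
      then show "q ^ 3 \<le> real m ^ 2" by (simp add: q(2)[symmetric] power_mult[symmetric])
    qed (use q m in auto)
    finally show ?thesis .
  qed
  have "card {x \<in> cube n. \<bar>y x\<bar> < s} \<le> card (T \<union> (few L (-1) \<union> (few M 1 \<union> few R (-1))))"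
    by (intro card_mono) (auto simp: T_def few_def)
  also have "\<dots> \<le> card T + card (few L (-1) \<union> (few M 1 \<union> few R (-1)))" by (rule card_Un_le)
  also have "\<dots> \<le> card T + (card (few L (-1)) + card (few M 1 \<union> few R (-1)))"
    by (intro add_left_mono card_Un_le)
  also have "\<dots> \<le> card T + (card (few L (-1)) + (card (few M 1) + card (few R (-1))))"
    by (intro add_left_mono card_Un_le)
  finally have "real (card {x \<in> cube n. \<bar>y x\<bar> < s})
      \<le> real (card T) + (real (card (few L (-1))) + (real (card (few M 1)) + real (card (few R (-1)))))"
    by linarith
  also have "\<dots> \<le> 2 ^ n * (64 / q ^ 3) + (2 ^ n * (361 / q ^ 3) + (2 ^ n * (361 / q ^ 3) + 2 ^ n * (361 / q ^ 3)))"
    using T2 few sub c by (intro add_mono) auto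
  \<comment> \<open>The constant is 64 + 3 * 361: typical points, and three exceptional
    sets.\<close>
  also have "\<dots> = 2 ^ n * (1147 / q ^ 3)" by (simp add: field_simps)
  finally show ?thesis by (simp add: y_def q3)
qed

text \<open>Changing the signs of the coordinates with negative weight is an involution of the cube,
  so the weights may be taken nonnegative.\<close>

lemma card_abs_weights:
  "card {x \<in> cube n. \<bar>affine_form n w \<theta> x\<bar> < s} = card {x \<in> cube n. \<bar>affine_form n (\<lambda>i. \<bar>w i\<bar>) \<theta> x\<bar> < s}"
proof -
  define \<sigma> where "\<sigma> i = (if w i < 0 then - 1 else 1 :: real)" for i
  define t where "t x = restrict (\<lambda>i. \<sigma> i * x i) {1..n}" for x
  have \<sigma>: "\<sigma> i * \<sigma> i = 1" "\<bar>w i\<bar> = w i * \<sigma> i" for i by (auto simp: \<sigma>_def)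
  have t_cube: "t x \<in> cube n" if "x \<in> cube n" for x
    using that by (auto simp: t_def cube_def \<sigma>_def PiE_def Pi_def)
  have tt: "t (t x) = x" if "x \<in> cube n" for x
    using that \<sigma>(1) by (auto simp: t_def cube_def fun_eq_iff PiE_def extensional_def simp flip: mult.assoc)
  have form: "affine_form n w \<theta> (t x) = affine_form n (\<lambda>i. \<bar>w i\<bar>) \<theta> x" for x
    unfolding affine_form_def by (simp add: t_def \<sigma>(2) mult.assoc)
  have form': "affine_form n w \<theta> x = affine_form n (\<lambda>i. \<bar>w i\<bar>) \<theta> (t x)" if "x \<in> cube n" for x
    using form[of "t x"] tt[OF that] by simp
  show ?thesis
    by (rule bij_betw_same_card[of t], rule bij_betw_byWitness[where f' = t])
       (use t_cube tt form form' in auto)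
qed

text \<open>Applied to absolute weights it cuts a set into consecutive blocks; applied to their
  negatives it selects the largest weights.\<close>

lemma smallest_subset:
  fixes a :: "'b \<Rightarrow> real"
  assumes "finite S" "j \<le> card S"
  obtains L where "L \<subseteq> S" "card L = j" "\<And>l p. l \<in> L \<Longrightarrow> p \<in> S - L \<Longrightarrow> a l \<le> a p"
proof -
  have "\<exists>L. L \<subseteq> S \<and> card L = j \<and> (\<forall>l\<in>L. \<forall>p\<in>S - L. a l \<le> a p)"
    using assms(2)
  proof (induction j)
    case 0
    show ?case by (rule exI[of _ "{}"]) auto
  next
    case (Suc j)
    then obtain L where L: "L \<subseteq> S" "card L = j" "\<forall>l\<in>L. \<forall>p\<in>S - L. a l \<le> a p" by auto
    have ne: "S - L \<noteq> {}" using L Suc.prems by auto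
    have fin: "finite (S - L)" using assms(1) by auto
    define p where "p = arg_min_on a (S - L)"
    have p: "p \<in> S - L" "\<And>q. q \<in> S - L \<Longrightarrow> a p \<le> a q"
      unfolding p_def using arg_min_if_finite[OF fin ne, of a] arg_min_least[OF fin ne, of _ a] by auto
    have "card (insert p L) = Suc j" using p L assms(1) by (auto simp: card_insert_if finite_subset)
    then show ?case using L p by (intro exI[of _ "insert p L"]) auto
  qed
  then show thesis using that by blast
qed

text \<open>Sorting \<open>S\<close> by absolute weight and cutting it into three consecutive blocks
  of size \<open>m\<close> gives the low, middle and high blocks of the crossing argument;
  separation turns the order into gaps of \<open>s\<close>.\<close>

theorem separated_small_ball:
  assumes S: "S \<subseteq> {1..n}" "card S = 3 * m" "m > 0" and s: "s > 0"
    and sep: "\<And>i j. i \<in> S \<Longrightarrow> j \<in> S \<Longrightarrow> i \<noteq> j \<Longrightarrow> \<bar>\<bar>w i\<bar> - \<bar>w j\<bar>\<bar> \<ge> s"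
  shows "real (card {x \<in> cube n. \<bar>affine_form n w \<theta> x\<bar> < s}) \<le> 2 ^ n * (1147 / (real m * sqrt (real m)))"
proof -
  have fin: "finite S" using S finite_subset by blast
  have gap: "\<bar>w i\<bar> + s \<le> \<bar>w j\<bar>" if "i \<in> S" "j \<in> S" "i \<noteq> j" "\<bar>w i\<bar> \<le> \<bar>w j\<bar>" for i j
    using sep[OF that(1-3)] that(4) by linarith
  obtain L where L: "L \<subseteq> S" "card L = m" "\<And>l p. l \<in> L \<Longrightarrow> p \<in> S - L \<Longrightarrow> \<bar>w l\<bar> \<le> \<bar>w p\<bar>"
    using smallest_subset[OF fin, of m "\<lambda>i. \<bar>w i\<bar>"] S by auto
  have cSL: "card (S - L) = 2 * m" using L S fin by (simp add: card_Diff_subset finite_subset)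
  obtain M where M: "M \<subseteq> S - L" "card M = m" "\<And>l p. l \<in> M \<Longrightarrow> p \<in> S - L - M \<Longrightarrow> \<bar>w l\<bar> \<le> \<bar>w p\<bar>"
    using smallest_subset[of "S - L" m "\<lambda>i. \<bar>w i\<bar>"] fin cSL by auto
  have cR: "card (S - L - M) = m" using M cSL fin by (subst card_Diff_subset) (auto intro: finite_subset)
  show ?thesis
    unfolding card_abs_weights[of n w]
  proof (rule card_blocks_small_ball[where L = L and M = M and R = "S - L - M"])
    fix l p assume *: "l \<in> L" "p \<in> M"
    then have "p \<in> S - L" "l \<in> S" "l \<noteq> p" using L M by auto
    then show "\<bar>w l\<bar> + s \<le> \<bar>w p\<bar>" using gap L(3) * by blast
  next
    fix p r assume *: "p \<in> M" "r \<in> S - L - M"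
    then show "\<bar>w p\<bar> + s \<le> \<bar>w r\<bar>" using gap[of p r] M by blast
  next
    fix p q assume *: "p \<in> M" "q \<in> M" "p \<noteq> q"
    then show "s \<le> \<bar>\<bar>w p\<bar> - \<bar>w q\<bar>\<bar>" using sep M by blast
  qed (use L M S cR s in auto)
qed

section \<open>Rounding and simultaneous approximation\<close>

text \<open>
  The condition on zero weights keeps a coordinate that the recursion has eliminated out of the integer form, so
  that the error event does not depend on it.
\<close>

definition int_approx :: "nat \<Rightarrow> (nat \<Rightarrow> real) \<Rightarrow> real \<Rightarrow> real \<Rightarrow> real \<Rightarrow> bool" where
  "int_approx n w \<theta> B \<delta> \<longleftrightarrow> (\<exists>(v :: nat \<Rightarrow> int) \<tau>.
     (\<forall>i\<in>{1..n}. w i = 0 \<longrightarrow> v i = 0) \<and> (\<Sum>i=1..n. \<bar>real_of_int (v i)\<bar>) + \<bar>\<tau>\<bar> \<le> B \<and>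
     real (card {x \<in> cube n. sign (affine_form n w \<theta> x) \<noteq> sign (affine_form n (\<lambda>i. real_of_int (v i)) \<tau> x)})
       \<le> \<delta> * 2 ^ n)"

lemma int_approxI:
  assumes "\<And>i. i \<in> {1..n} \<Longrightarrow> w i = 0 \<Longrightarrow> v i = 0"
    and "(\<Sum>i=1..n. \<bar>real_of_int (v i)\<bar>) + \<bar>\<tau>\<bar> \<le> B"
    and "real (card {x \<in> cube n. sign (affine_form n w \<theta> x) \<noteq> sign (affine_form n (\<lambda>i. real_of_int (v i)) \<tau> x)})
       \<le> \<delta> * 2 ^ n"
  shows "int_approx n w \<theta> B \<delta>"
  using assms unfolding int_approx_def by blast

lemma int_approx_mono:
  assumes "int_approx n w \<theta> B \<delta>" "B \<le> B'" "\<delta> \<le> \<delta>'"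
  shows "int_approx n w \<theta> B' \<delta>'"
proof -
  have "\<delta> * 2 ^ n \<le> \<delta>' * 2 ^ n" using assms(3) by simp
  then show ?thesis using assms(1,2) unfolding int_approx_def by (meson order_trans)
qed

lemma int_approx_constant:
  assumes "\<And>x. x \<in> cube n \<Longrightarrow> sign (affine_form n w \<theta> x) = a" "B \<ge> 1"
  shows "int_approx n w \<theta> B 0"
proof -
  obtain x where x: "x \<in> cube n" using cube_nonempty by blast
  have a: "a = - 1 \<or> a = 1" using assms(1)[OF x] by (auto simp: sign_def split: if_splits)
  have e: "{x \<in> cube n. sign (affine_form n w \<theta> x) \<noteq> sign (affine_form n (\<lambda>i. real_of_int 0) (- a) x)} = {}"
    using assms(1) a by (auto simp: affine_form_def sign_def)
  \<comment> \<open>With zero weights and threshold \<open>- a\<close> the form is constantly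
    \<open>a\<close>, which is its own sign.\<close>
  show ?thesis
    by (rule int_approxI[where v = "\<lambda>_. 0" and \<tau> = "- a"])
       (unfold e, use assms(2) a in auto)
qed

lemma affine_form_sum_bound:
  assumes "x \<in> cube n"
  shows "\<bar>\<Sum>i=1..n. w i * x i\<bar> \<le> (\<Sum>i=1..n. \<bar>w i\<bar>)"
proof -
  have "\<bar>\<Sum>i=1..n. w i * x i\<bar> \<le> (\<Sum>i=1..n. \<bar>w i * x i\<bar>)" by (rule sum_abs)
  also have "\<dots> = (\<Sum>i=1..n. \<bar>w i\<bar>)"
  proof (rule sum.cong[OF refl])
    fix i assume "i \<in> {1..n}"
    then show "\<bar>w i * x i\<bar> = \<bar>w i\<bar>" using cube_cases[OF assms, of i] by (auto simp: abs_mult)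
  qed
  finally show ?thesis .
qed

lemma int_approx_large_threshold:
  assumes "\<bar>\<theta>\<bar> > (\<Sum>i=1..n. \<bar>w i\<bar>)" "B \<ge> 1"
  shows "int_approx n w \<theta> B 0"
proof (rule int_approx_constant[where a = "if \<theta> > 0 then - 1 else 1"])
  fix x assume "x \<in> cube n"
  then show "sign (affine_form n w \<theta> x) = (if \<theta> > 0 then - 1 else 1)"
    using affine_form_sum_bound[of x n w] assms(1) unfolding affine_form_def sign_def by auto
qed (fact assms)

lemma card_chebyshev:
  assumes e: "\<And>i. i \<in> {1..n} \<Longrightarrow> \<bar>e i\<bar> \<le> 1" and n: "n \<ge> 1" and \<epsilon>: "\<epsilon> > 0"
  shows "real (card {x \<in> cube n. \<bar>\<Sum>i=1..n. e i * x i\<bar> \<ge> sqrt (real n / \<epsilon>)}) \<le> \<epsilon> * 2 ^ n"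
proof -
  let ?S = "{x \<in> cube n. \<bar>\<Sum>i=1..n. e i * x i\<bar> \<ge> sqrt (real n / \<epsilon>)}"
  have "real (card ?S) * (real n / \<epsilon>) = (\<Sum>x\<in>?S. real n / \<epsilon>)" by simp
  also have "\<dots> \<le> (\<Sum>x\<in>?S. (\<Sum>i=1..n. e i * x i)\<^sup>2)"
  proof (rule sum_mono)
    fix x assume "x \<in> ?S"
    then have "(sqrt (real n / \<epsilon>))\<^sup>2 \<le> \<bar>\<Sum>i=1..n. e i * x i\<bar>\<^sup>2" using \<epsilon> by (intro power_mono) auto
    then show "real n / \<epsilon> \<le> (\<Sum>i=1..n. e i * x i)\<^sup>2" using \<epsilon> by simp
  qed
  also have "\<dots> \<le> (\<Sum>x\<in>cube n. (\<Sum>i=1..n. e i * x i)\<^sup>2)" by (intro sum_mono2) auto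
  also have "\<dots> = 2 ^ n * (\<Sum>i=1..n. (e i)\<^sup>2)" by (rule sum_cube_square) simp
  also have "\<dots> \<le> 2 ^ n * (\<Sum>i=1..n. 1)"
    using e by (intro mult_left_mono sum_mono) (auto simp: abs_square_le_1)
  finally have "real (card ?S) * (real n / \<epsilon>) \<le> 2 ^ n * real n" by simp
  then show ?thesis using n \<epsilon> by (simp add: field_simps)
qed

text \<open>The scale \<open>r\<close> makes \<open>r * s = sqrt (n / \<epsilon>)\<close>. Off the
  ball the scaled form has at least this size, and by Chebyshev the rounding error reaches it on at
  most a fraction \<epsilon> of the cube; hence the total \<open>2 * \<epsilon>\<close>.\<close>

lemma int_approx_rounding:
  assumes n: "n \<ge> 1" and s: "s > 0" and \<epsilon>: "\<epsilon> > 0"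
    and small: "real (card {x \<in> cube n. \<bar>affine_form n w \<theta> x\<bar> < s}) \<le> \<epsilon> * 2 ^ n"
    and B: "2 * (\<Sum>i=1..n. \<bar>w i\<bar>) * (sqrt (real n / \<epsilon>) / s) \<le> B" "B \<ge> 1"
  shows "int_approx n w \<theta> B (2 * \<epsilon>)"
proof (cases "\<bar>\<theta>\<bar> > (\<Sum>i=1..n. \<bar>w i\<bar>)")
  case True
  then show ?thesis using int_approx_large_threshold[OF True B(2)] \<epsilon> by (auto elim: int_approx_mono)
next
  case False
  define r where "r = sqrt (real n / \<epsilon>) / s"
  have r: "r > 0" using n s \<epsilon> by (simp add: r_def)
  \<comment> \<open>Rounding is towards zero, so no weight grows in absolute value and zero weights
    stay zero.\<close>
  define v where "v i = (if w i \<ge> 0 then \<lfloor>r * w i\<rfloor> else - \<lfloor>- (r * w i)\<rfloor>)" for i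
  have v_le: "\<bar>real_of_int (v i)\<bar> \<le> r * \<bar>w i\<bar>" and v_err: "\<bar>r * w i - real_of_int (v i)\<bar> \<le> 1" for i
  proof -
    have sgn: "w i \<ge> 0 \<Longrightarrow> r * w i \<ge> 0" "w i < 0 \<Longrightarrow> r * w i \<le> 0"
      using r by (auto simp: mult_le_0_iff)
    have fl: "0 \<le> real_of_int \<lfloor>t\<rfloor> \<and> real_of_int \<lfloor>t\<rfloor> \<le> t \<and> t \<le> real_of_int \<lfloor>t\<rfloor> + 1" if "t \<ge> 0" for t :: real
      using that by (simp add: floor_correct)
    have abs: "r * \<bar>w i\<bar> = \<bar>r * w i\<bar>" using r by (simp add: abs_mult)
    have "\<bar>real_of_int (v i)\<bar> \<le> r * \<bar>w i\<bar> \<and> \<bar>r * w i - real_of_int (v i)\<bar> \<le> 1"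
    proof (cases "w i \<ge> 0")
      case True
      then have v: "v i = \<lfloor>r * w i\<rfloor>" by (simp add: v_def)
      show ?thesis unfolding v abs using fl[OF sgn(1)[OF True]] by (intro conjI; linarith)
    next
      case False
      then have v: "v i = - \<lfloor>- (r * w i)\<rfloor>" and neg: "- (r * w i) \<ge> 0" using sgn(2) by (auto simp: v_def)
      show ?thesis unfolding v abs of_int_minus using fl[OF neg] by (intro conjI; linarith)
    qed
    then show "\<bar>real_of_int (v i)\<bar> \<le> r * \<bar>w i\<bar>" "\<bar>r * w i - real_of_int (v i)\<bar> \<le> 1" by auto
  qed
  define e where "e i = r * w i - real_of_int (v i)" for i
  let ?S1 = "{x \<in> cube n. \<bar>affine_form n w \<theta> x\<bar> < s}"
  let ?S2 = "{x \<in> cube n. \<bar>\<Sum>i=1..n. e i * x i\<bar> \<ge> sqrt (real n / \<epsilon>)}"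
  let ?Bad = "{x \<in> cube n. sign (affine_form n w \<theta> x) \<noteq> sign (affine_form n (\<lambda>i. real_of_int (v i)) (r * \<theta>) x)}"
  have "?Bad \<subseteq> ?S1 \<union> ?S2"
  proof (rule subsetI, rule ccontr)
    fix x assume x: "x \<in> ?Bad" "x \<notin> ?S1 \<union> ?S2"
    then have c: "x \<in> cube n" and a: "s \<le> \<bar>affine_form n w \<theta> x\<bar>"
      and b: "\<bar>\<Sum>i=1..n. e i * x i\<bar> < r * s" using s by (auto simp: r_def)
    have eq: "affine_form n (\<lambda>i. real_of_int (v i)) (r * \<theta>) x = r * affine_form n w \<theta> x - (\<Sum>i=1..n. e i * x i)"
      by (simp add: affine_form_def e_def algebra_simps sum_subtractf sum_distrib_left)
    have "r * s \<le> r * \<bar>affine_form n w \<theta> x\<bar>" using a r by simp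
    then have "r * s \<le> \<bar>r * affine_form n w \<theta> x\<bar>" using r by (simp add: abs_mult)
    moreover have "r * affine_form n w \<theta> x \<ge> 0 \<longleftrightarrow> affine_form n w \<theta> x \<ge> 0"
      using r by (simp add: zero_le_mult_iff)
    ultimately have "sign (affine_form n (\<lambda>i. real_of_int (v i)) (r * \<theta>) x) = sign (affine_form n w \<theta> x)"
      unfolding eq sign_def using b by argo
    then show False using x by simp
  qed
  then have "card ?Bad \<le> card (?S1 \<union> ?S2)" by (intro card_mono) auto
  also have "\<dots> \<le> card ?S1 + card ?S2" by (rule card_Un_le)
  finally have "real (card ?Bad) \<le> real (card ?S1) + real (card ?S2)" by linarith
  also have "\<dots> \<le> \<epsilon> * 2 ^ n + \<epsilon> * 2 ^ n"
    using v_err by (intro add_mono small card_chebyshev n \<epsilon>) (simp add: e_def)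
  finally have bad: "real (card ?Bad) \<le> 2 * \<epsilon> * 2 ^ n" by simp
  have "(\<Sum>i=1..n. \<bar>real_of_int (v i)\<bar>) \<le> r * (\<Sum>i=1..n. \<bar>w i\<bar>)"
    unfolding sum_distrib_left by (intro sum_mono v_le)
  \<comment> \<open>The threshold is scaled without rounding. It costs as much as the weights at
    most, which explains the factor 2 in the hypothesis on \<open>B\<close>.\<close>
  moreover have "\<bar>r * \<theta>\<bar> \<le> r * (\<Sum>i=1..n. \<bar>w i\<bar>)"
    using False r by (simp add: abs_mult)
  ultimately have "(\<Sum>i=1..n. \<bar>real_of_int (v i)\<bar>) + \<bar>r * \<theta>\<bar> \<le> B"
    using B(1) unfolding r_def[symmetric] by (simp add: mult_ac)
  then show ?thesis
    by (intro int_approxI[where v = v and \<tau> = "r * \<theta>"] bad) (auto simp: v_def)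
qed

section \<open>Simultaneous Diophantine approximation of clustered weights\<close>

lemma dirichlet_finite:
  fixes g :: "'b \<Rightarrow> real"
  assumes "finite S" "T > 0"
  obtains q :: int and p :: "'b \<Rightarrow> int"
  where "0 < q" "q \<le> int (T ^ card S)" "\<And>i. i \<in> S \<Longrightarrow> \<bar>of_int q * g i - of_int (p i)\<bar> < 1 / real T"
proof -
  obtain h where h: "bij_betw h S {..<card S}"
    using ex_bij_betw_finite_nat[OF assms(1)] by (auto simp: atLeast0LessThan)
  obtain q p where qp: "0 < q" "q \<le> int (T ^ card S)"
    "\<And>i. i < card S \<Longrightarrow> \<bar>of_int q * g (inv_into S h i) - of_int (p i)\<bar> < 1 / real T"
    using Dirichlet_approx_simult[OF assms(2), of "card S" "\<lambda>i. g (inv_into S h i)"] by metis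
  show thesis
  proof (rule that[of q "\<lambda>i. p (h i)"])
    fix i assume i: "i \<in> S"
    then have "h i < card S" using h by (auto simp: bij_betw_def)
    then show "\<bar>of_int q * g i - of_int (p (h i))\<bar> < 1 / real T"
      using qp(3)[of "h i"] i h by (simp add: bij_betw_def)
  qed (use qp in auto)
qed

text \<open>A separated subset of largest cardinality is a net: a point far from all its members
  could be added to it.\<close>

lemma maximal_separated:
  fixes a :: "'b \<Rightarrow> real"
  assumes fin: "finite I" and \<beta>: "\<beta> > 0"
  obtains S where "S \<subseteq> I" "\<And>i j. i \<in> S \<Longrightarrow> j \<in> S \<Longrightarrow> i \<noteq> j \<Longrightarrow> \<bar>a i - a j\<bar> \<ge> \<beta>"
    "\<And>i. i \<in> I \<Longrightarrow> \<exists>c\<in>S. \<bar>a i - a c\<bar> < \<beta>"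
proof -
  let ?sep = "\<lambda>S. S \<subseteq> I \<and> (\<forall>i\<in>S. \<forall>j\<in>S. i \<noteq> j \<longrightarrow> \<bar>a i - a j\<bar> \<ge> \<beta>)"
  have "\<exists>S. ?sep S \<and> (\<forall>S'. ?sep S' \<longrightarrow> card S' \<le> card S)"
  proof (rule ex_has_greatest_nat[of ?sep "{}" card "Suc (card I)"])
    show "\<forall>S. ?sep S \<longrightarrow> card S < Suc (card I)"
      using card_mono[OF fin] by (simp add: less_Suc_eq_le)
  qed simp
  then obtain S where S': "?sep S \<and> (\<forall>S'. ?sep S' \<longrightarrow> card S' \<le> card S)" by (rule exE)
  note S = conjunct1[OF S']
  have "\<exists>c\<in>S. \<bar>a i - a c\<bar> < \<beta>" if i: "i \<in> I" for i
  proof (rule ccontr)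
    assume *: "\<not> (\<exists>c\<in>S. \<bar>a i - a c\<bar> < \<beta>)"
    then have S3: "\<forall>c\<in>S. \<beta> \<le> \<bar>a i - a c\<bar>" by (simp add: not_less)
    then have "i \<notin> S" using \<beta> by auto
    moreover have "finite S" using S fin finite_subset by blast
    ultimately have "card (insert i S) = Suc (card S)" by simp
    moreover have far: "\<beta> \<le> \<bar>a i - a c\<bar>" "\<beta> \<le> \<bar>a c - a i\<bar>" if "c \<in> S" for c
      using bspec[OF S3 that] by (simp_all add: abs_minus_commute[of "a c"])
    then have "?sep (insert i S)" using S i by blast
    ultimately show False using S'[THEN conjunct2, THEN spec, of "insert i S"] by simp
  qed
  then show thesis using S by (intro that[of S]) auto
qed

lemma affine_form_Ints:
  assumes "x \<in> cube n"
  shows "affine_form n (\<lambda>i. real_of_int (l i)) (real_of_int u) x \<in> \<int>"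
proof -
  have "real_of_int (l i) * x i \<in> \<int>" if "i \<in> {1..n}" for i
    using cube_cases[OF assms that] by auto
  then show ?thesis unfolding affine_form_def by (intro Ints_diff Ints_sum) auto
qed

text \<open>Only the cluster centres and the threshold, at most \<open>\<kappa> + 1\<close> numbers,
  are approximated with a common denominator; a large weight inherits the numerator of its centre,
  and a small one is replaced by 0. The total error on the cube stays below 1, so a nonzero integer
  value of the new form must have the sign of the old one.\<close>

lemma small_integer_form:
  fixes K \<kappa> T :: nat and w :: "nat \<Rightarrow> real"
  defines "T \<equiv> 4 * (K + 1)"
  defines "\<Lambda> \<equiv> 2 * real T ^ (\<kappa> + 1)"
  assumes n: "n \<ge> 1" and A: "A > 0" "j \<in> {1..n}" "\<bar>w j\<bar> = A" "\<And>i. i \<in> {1..n} \<Longrightarrow> \<bar>w i\<bar> \<le> A"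
    and \<beta>: "\<beta> = A / (real n * \<Lambda>)"
    and K: "card {i \<in> {1..n}. \<bar>w i\<bar> \<ge> \<beta>} \<le> K"
    and clusters: "\<And>S. S \<subseteq> {i \<in> {1..n}. \<bar>w i\<bar> \<ge> \<beta>} \<Longrightarrow>
       (\<And>i j. i \<in> S \<Longrightarrow> j \<in> S \<Longrightarrow> i \<noteq> j \<Longrightarrow> \<bar>\<bar>w i\<bar> - \<bar>w j\<bar>\<bar> \<ge> \<beta>) \<Longrightarrow> card S \<le> \<kappa>"
    and \<theta>: "\<bar>\<theta>\<bar> \<le> (\<Sum>i=1..n. \<bar>w i\<bar>)"
  obtains l :: "nat \<Rightarrow> int" and u :: int
  where "\<And>i. i \<in> {1..n} \<Longrightarrow> w i = 0 \<Longrightarrow> l i = 0" "l j \<noteq> 0"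
    "(\<Sum>i=1..n. \<bar>real_of_int (l i)\<bar>) + \<bar>real_of_int u\<bar> \<le> 3 * real (K + 1) * real T ^ (\<kappa> + 1)"
    "\<And>x. x \<in> cube n \<Longrightarrow> affine_form n (\<lambda>i. real_of_int (l i)) (real_of_int u) x \<noteq> 0 \<Longrightarrow>
       \<bar>affine_form n (\<lambda>i. real_of_int (l i)) (real_of_int u) x\<bar> \<ge> 1 \<and>
       sign (affine_form n w \<theta> x) = sign (affine_form n (\<lambda>i. real_of_int (l i)) (real_of_int u) x)"
proof -
  define I where "I = {i \<in> {1..n}. \<bar>w i\<bar> \<ge> \<beta>}"
  have T: "T \<ge> 4" by (simp add: T_def)
  have \<Lambda>: "\<Lambda> > 0" using T by (simp add: \<Lambda>_def)
  have \<Lambda>2: "\<Lambda> \<ge> 2" using T one_le_power[of "real T" "\<kappa> + 1"] by (simp add: \<Lambda>_def)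
  have \<beta>0: "\<beta> > 0" using \<beta> n \<Lambda> A by simp
  have n\<beta>: "real n * \<beta> = A / \<Lambda>" using \<beta> n by simp
  have "1 \<le> real n * \<Lambda>" using mult_mono[of 1 "real n" 1 \<Lambda>] n \<Lambda>2 by simp
  then have \<beta>A: "\<beta> \<le> A" using A unfolding \<beta> by (simp add: field_simps)
  have finI: "finite I" by (simp add: I_def)
  obtain S where S: "S \<subseteq> I" "\<And>i j. i \<in> S \<Longrightarrow> j \<in> S \<Longrightarrow> i \<noteq> j \<Longrightarrow> \<bar>\<bar>w i\<bar> - \<bar>w j\<bar>\<bar> \<ge> \<beta>"
    "\<And>i. i \<in> I \<Longrightarrow> \<exists>c\<in>S. \<bar>\<bar>w i\<bar> - \<bar>w c\<bar>\<bar> < \<beta>"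
    using maximal_separated[OF finI \<beta>0, of "\<lambda>i. \<bar>w i\<bar>"] by metis
  have cS: "card S \<le> \<kappa>" using clusters S unfolding I_def by blast
  obtain c where c: "\<And>i. i \<in> I \<Longrightarrow> c i \<in> S" "\<And>i. i \<in> I \<Longrightarrow> \<bar>\<bar>w i\<bar> - \<bar>w (c i)\<bar>\<bar> < \<beta>"
    using S(3) by metis
  have finS: "finite S" using S finI finite_subset by blast
  have S0: "0 \<notin> S" using S by (auto simp: I_def)
  \<comment> \<open>Index 0 is not a coordinate, so it can carry the threshold; everything is
    normalised by the largest weight.\<close>
  define g where "g i = (if i = 0 then \<theta> else \<bar>w i\<bar>) / A" for i :: nat
  obtain q p where q: "0 < q" "q \<le> int (T ^ card (insert 0 S))"
    and p: "\<And>i. i \<in> insert 0 S \<Longrightarrow> \<bar>of_int q * g i - of_int (p i)\<bar> < 1 / real T"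
    using dirichlet_finite[of "insert 0 S" T g] finS T by (metis finite_insert le_zero_eq not_gr_zero zero_neq_numeral)
  define Q where "Q = real_of_int q"
  have Q1: "Q \<ge> 1" using q by (simp add: Q_def)
  have QT: "Q \<le> real T ^ (\<kappa> + 1)"
  proof -
    have "real_of_int q \<le> real_of_int (int (T ^ card (insert 0 S)))" using q(2) by (simp only: of_int_le_iff)
    then have "Q \<le> real T ^ card (insert 0 S)" by (simp add: Q_def)
    also have "\<dots> \<le> real T ^ (\<kappa> + 1)"
      using T cS S0 finS by (intro power_increasing) auto
    finally show ?thesis .
  qed
  have Q\<Lambda>: "Q / \<Lambda> \<le> 1 / 2" using QT \<Lambda> by (simp add: \<Lambda>_def field_simps)
  have T1: "1 / real T \<le> 1 / 4" using T by (simp add: field_simps)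
  define \<sigma> where "\<sigma> i = (if w i \<ge> 0 then 1 else - 1 :: int)" for i
  define l where "l i = (if i \<in> I then \<sigma> i * p (c i) else 0)" for i
  \<comment> \<open>The error, after scaling by \<open>Q / A\<close>, of moving one weight by
    \<open>\<beta>\<close>. Since \<Lambda> is twice the bound on \<open>Q\<close>, all
    \<open>n\<close> such errors together stay within 1/2.\<close>
  define b where "b = Q * \<beta> / A"
  have nb: "real n * b \<le> 1 / 2"
  proof -
    have "real n * b = Q * (real n * \<beta>) / A" by (simp add: b_def)
    also have "\<dots> = Q / \<Lambda>" unfolding n\<beta> using A by simp
    finally show ?thesis using Q\<Lambda> by simp
  qed
  have b0: "b \<ge> 0" using Q1 \<beta>0 A by (simp add: b_def)
  have gS: "g i = \<bar>w i\<bar> / A" if "i \<in> S" for i using that S0 by (auto simp: g_def)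
  have pc: "\<bar>Q * (\<bar>w (c i)\<bar> / A) - real_of_int (p (c i))\<bar> \<le> 1 / real T" if "i \<in> I" for i
    using p[of "c i"] gS[OF c(1)[OF that]] c(1)[OF that] by (simp add: Q_def)
  have diff: "\<bar>Q * (\<bar>w i\<bar> / A) - Q * (\<bar>w (c i)\<bar> / A)\<bar> \<le> b" if "i \<in> I" for i
  proof -
    have "\<bar>Q * (\<bar>w i\<bar> / A) - Q * (\<bar>w (c i)\<bar> / A)\<bar> = Q * \<bar>\<bar>w i\<bar> - \<bar>w (c i)\<bar>\<bar> / A"
      using Q1 A by (simp add: abs_mult abs_divide flip: right_diff_distrib diff_divide_distrib)
    also have "\<dots> \<le> Q * \<beta> / A" using c(2)[OF that] Q1 A by (intro divide_right_mono mult_left_mono) auto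
    finally show ?thesis by (simp add: b_def)
  qed
  have abs_pc: "\<bar>real_of_int (p (c i))\<bar> \<le> Q + 1" if "i \<in> I" for i
  proof -
    have "c i \<in> {1..n}" using c(1)[OF that] S by (auto simp: I_def)
    then have "\<bar>w (c i)\<bar> / A \<le> 1" using A by simp
    then have "Q * (\<bar>w (c i)\<bar> / A) \<le> Q * 1" using Q1 by (intro mult_left_mono) auto
    moreover have "Q * (\<bar>w (c i)\<bar> / A) \<ge> 0" using Q1 A by simp
    ultimately show ?thesis using pc[OF that] T1 by linarith
  qed
  have coeff: "\<bar>real_of_int (l i) - Q / A * w i\<bar> \<le> of_bool (i \<in> I) / real T + b" if i: "i \<in> {1..n}" for i
  proof (cases "i \<in> I")
    case True
    have \<sigma>w: "w i = real_of_int (\<sigma> i) * \<bar>w i\<bar>" by (simp add: \<sigma>_def)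
    have "real_of_int (l i) - Q / A * w i = real_of_int (\<sigma> i) * (real_of_int (p (c i)) - Q * (\<bar>w i\<bar> / A))"
      using True by (subst \<sigma>w) (simp add: l_def algebra_simps)
    then have "\<bar>real_of_int (l i) - Q / A * w i\<bar> = \<bar>real_of_int (p (c i)) - Q * (\<bar>w i\<bar> / A)\<bar>"
      by (simp add: abs_mult \<sigma>_def)
    moreover have "of_bool (i \<in> I) / real T = 1 / real T" using True by simp
    ultimately show ?thesis using pc[OF True] diff[OF True] by linarith
  next
    case False
    then have "\<bar>w i\<bar> \<le> \<beta>" using i by (auto simp: I_def)
    then have "Q / A * \<bar>w i\<bar> \<le> Q / A * \<beta>" using Q1 A by (intro mult_left_mono) auto
    then show ?thesis using False Q1 A by (simp add: l_def abs_mult b_def)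
  qed
  have cardI: "real (card I) \<le> real K" using K by (simp add: I_def)
  have indI: "(\<Sum>i=1..n. of_bool (i \<in> I) * t) = real (card I) * t" for t :: real
  proof -
    have "{1..n} \<inter> {i. i \<in> I} = I" by (auto simp: I_def)
    then show ?thesis by (simp add: sum.If_cases of_bool_def flip: sum_distrib_right)
  qed
  have close: "\<bar>affine_form n (\<lambda>i. real_of_int (l i)) (real_of_int (p 0)) x - Q / A * affine_form n w \<theta> x\<bar> < 1"
    if x: "x \<in> cube n" for x
  proof -
    have "affine_form n (\<lambda>i. real_of_int (l i)) (real_of_int (p 0)) x - Q / A * affine_form n w \<theta> x
        = (\<Sum>i=1..n. (real_of_int (l i) - Q / A * w i) * x i) + (Q * g 0 - real_of_int (p 0))"
      by (simp add: affine_form_def g_def algebra_simps sum_subtractf sum_distrib_left)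
    moreover have "\<bar>\<Sum>i=1..n. (real_of_int (l i) - Q / A * w i) * x i\<bar> \<le> (\<Sum>i=1..n. \<bar>real_of_int (l i) - Q / A * w i\<bar>)"
      by (rule affine_form_sum_bound[OF x])
    moreover have "(\<Sum>i=1..n. \<bar>real_of_int (l i) - Q / A * w i\<bar>) \<le> (\<Sum>i=1..n. of_bool (i \<in> I) * (1 / real T) + b)"
      using coeff by (intro sum_mono) simp
    moreover have "(\<Sum>i=1..n. of_bool (i \<in> I) * (1 / real T) + b) = real (card I) / real T + real n * b"
      unfolding sum.distrib indI by simp
    moreover have "real (card I) / real T \<le> real K / real T" using cardI by (simp add: divide_right_mono)
    moreover have "\<bar>Q * g 0 - real_of_int (p 0)\<bar> < 1 / real T" using p[of 0] by (simp add: Q_def)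
    \<comment> \<open>\<open>T\<close> is chosen for this: the Dirichlet errors of at most
      \<open>K\<close> weights and of the threshold total 1/4, which with
      \<open>n * b \<le> 1 / 2\<close> leaves the sum below 1.\<close>
    moreover have "real K / real T + 1 / real T = 1 / 4" by (simp add: T_def field_simps)
    ultimately show ?thesis using nb by linarith
  qed
  \<comment> \<open>At most \<open>K\<close> weights are large, each at most \<open>A\<close>; the
    small ones add up to at most \<open>n * \<beta> = A / \<Lambda>\<close>.\<close>
  have w1: "(\<Sum>i=1..n. \<bar>w i\<bar>) \<le> real (K + 1) * A"
  proof -
    have "(\<Sum>i=1..n. \<bar>w i\<bar>) \<le> (\<Sum>i=1..n. of_bool (i \<in> I) * A + \<beta>)"
      using A \<beta>0 by (intro sum_mono) (auto simp: I_def of_bool_def intro: add_increasing2 less_imp_le)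
    also have "\<dots> = real (card I) * A + A / \<Lambda>" unfolding sum.distrib indI by (simp add: n\<beta>)
    also have "\<dots> \<le> real K * A + A"
      using cardI A \<Lambda>2 by (intro add_mono mult_right_mono) (auto simp: field_simps)
    finally show ?thesis by (simp add: algebra_simps)
  qed
  have u: "\<bar>real_of_int (p 0)\<bar> \<le> Q * real (K + 1) + 1"
  proof -
    have "\<bar>\<theta>\<bar> / A \<le> real (K + 1)" using \<theta> w1 A by (simp add: field_simps)
    then have "Q * (\<bar>\<theta>\<bar> / A) \<le> Q * real (K + 1)" using Q1 by (intro mult_left_mono) auto
    moreover have "\<bar>Q * g 0\<bar> = Q * (\<bar>\<theta>\<bar> / A)" using Q1 A by (simp add: g_def abs_mult)
    moreover have "\<bar>Q * g 0 - real_of_int (p 0)\<bar> < 1 / real T" using p[of 0] by (simp add: Q_def)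
    ultimately show ?thesis using T1 by linarith
  qed
  have lsum: "(\<Sum>i=1..n. \<bar>real_of_int (l i)\<bar>) \<le> real K * (Q + 1)"
  proof -
    have "(\<Sum>i=1..n. \<bar>real_of_int (l i)\<bar>) \<le> (\<Sum>i=1..n. of_bool (i \<in> I) * (Q + 1))"
      using abs_pc by (intro sum_mono) (auto simp: l_def \<sigma>_def abs_mult)
    also have "\<dots> = real (card I) * (Q + 1)" by (rule indI)
    finally show ?thesis using mult_right_mono[OF cardI, of "Q + 1"] Q1 by linarith
  qed
  show thesis
  proof (rule that[of l "p 0"])
    fix i assume "i \<in> {1..n}" "w i = 0"
    then show "l i = 0" using \<beta>0 by (simp add: l_def I_def)
  next
    have jI: "j \<in> I" using A \<beta>A by (simp add: I_def)
    \<comment> \<open>For the largest weight the target is \<open>Q \<ge> 1\<close>, and the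
      numerator of its centre lies within 1/4 + 1/2 of it.\<close>
    have "Q * (\<bar>w j\<bar> / A) = Q" using A by simp
    moreover have "b \<le> real n * b" using b0 n by (simp add: mult_le_cancel_right1)
    ultimately have "real_of_int (p (c j)) > 0"
      using pc[OF jI] diff[OF jI] nb Q1 T1 by linarith
    then show "l j \<noteq> 0" using jI by (simp add: l_def \<sigma>_def)
  next
    have "(\<Sum>i=1..n. \<bar>real_of_int (l i)\<bar>) + \<bar>real_of_int (p 0)\<bar> \<le> real K * (Q + 1) + (Q * real (K + 1) + 1)"
      using lsum u by simp
    also have "\<dots> \<le> 3 * real (K + 1) * Q"
      using Q1 mult_left_mono[OF Q1, of "real K"] by (simp add: algebra_simps)
    also have "\<dots> \<le> 3 * real (K + 1) * real T ^ (\<kappa> + 1)" by (intro mult_left_mono QT) simp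
    finally show "(\<Sum>i=1..n. \<bar>real_of_int (l i)\<bar>) + \<bar>real_of_int (p 0)\<bar> \<le> 3 * real (K + 1) * real T ^ (\<kappa> + 1)" .
  next
    fix x assume x: "x \<in> cube n"
    let ?l = "affine_form n (\<lambda>i. real_of_int (l i)) (real_of_int (p 0)) x"
    assume nz: "?l \<noteq> 0"
    have ge1: "\<bar>?l\<bar> \<ge> 1" using affine_form_Ints[OF x] nz by (rule Ints_nonzero_abs_ge1)
    have "Q / A > 0" using Q1 A by simp
    then have "Q / A * affine_form n w \<theta> x \<ge> 0 \<longleftrightarrow> affine_form n w \<theta> x \<ge> 0"
      by (simp only: zero_le_mult_iff) auto
    then have "sign (affine_form n w \<theta> x) = sign ?l"
      using close[OF x] ge1 unfolding sign_def by argo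
    with ge1 show "\<bar>?l\<bar> \<ge> 1 \<and> sign (affine_form n w \<theta> x) = sign ?l" by blast
  qed
qed

section \<open>The recursion\<close>

text \<open>The choice of \<open>c\<close> makes weight \<open>j\<close> of the remainder vanish, so
  by the support condition \<open>v j = 0\<close>, and the error event \<open>?E2\<close> of the
  remainder is invariant under flipping \<open>j\<close>. Errors of the combined form lie in
  \<open>?E2\<close> with \<open>L x = 0\<close>, and the flip destroys \<open>L x = 0\<close>, so
  they fill at most half of \<open>?E2\<close>.\<close>

lemma int_approx_step:
  fixes n :: nat and l :: "nat \<Rightarrow> int" and u :: int
  defines "L \<equiv> affine_form n (\<lambda>i. real_of_int (l i)) (real_of_int u)"
  assumes supp: "\<And>i. i \<in> {1..n} \<Longrightarrow> w i = 0 \<Longrightarrow> l i = 0" and j: "j \<in> {1..n}" "l j \<noteq> 0"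
    and bound: "(\<Sum>i=1..n. \<bar>real_of_int (l i)\<bar>) + \<bar>real_of_int u\<bar> \<le> D"
    and L: "\<And>x. x \<in> cube n \<Longrightarrow> L x \<noteq> 0 \<Longrightarrow> \<bar>L x\<bar> \<ge> 1 \<and> sign (affine_form n w \<theta> x) = sign (L x)"
    and c: "c = w j / real_of_int (l j)"
    and rec: "int_approx n (\<lambda>i. w i - c * real_of_int (l i)) (\<theta> - c * real_of_int u) B \<delta>"
    and B: "B \<ge> 0"
  shows "int_approx n w \<theta> ((B + 1) * D + B) (\<delta> / 2)"
proof -
  define w2 where "w2 i = w i - c * real_of_int (l i)" for i
  define \<theta>2 where "\<theta>2 = \<theta> - c * real_of_int u"
  obtain v \<tau> where v: "\<And>i. i \<in> {1..n} \<Longrightarrow> w2 i = 0 \<Longrightarrow> v i = 0"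
    and vB: "(\<Sum>i=1..n. \<bar>real_of_int (v i)\<bar>) + \<bar>\<tau>\<bar> \<le> B"
    and err: "real (card {x \<in> cube n. sign (affine_form n w2 \<theta>2 x) \<noteq> sign (affine_form n (\<lambda>i. real_of_int (v i)) \<tau> x)})
       \<le> \<delta> * 2 ^ n"
    using rec unfolding int_approx_def w2_def[symmetric] \<theta>2_def[symmetric] by blast
  define V where "V = affine_form n (\<lambda>i. real_of_int (v i)) \<tau>"
  \<comment> \<open>An integer above \<open>B\<close>, and thus above every value of
    \<open>V\<close>: the term \<open>H * L\<close> decides the sign wherever \<open>L\<close> is
    nonzero.\<close>
  define H where "H = \<lfloor>B\<rfloor> + 1"
  have H: "B < real_of_int H" "real_of_int H \<le> B + 1" by (auto simp: H_def)
  define v' where "v' i = H * l i + v i" for i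
  define \<tau>' where "\<tau>' = real_of_int H * real_of_int u + \<tau>"
  have comb: "affine_form n (\<lambda>i. real_of_int (v' i)) \<tau>' x = real_of_int H * L x + V x" for x
    by (simp add: affine_form_def L_def V_def v'_def \<tau>'_def algebra_simps sum.distrib sum_distrib_left)
  have w2: "affine_form n w2 \<theta>2 x = affine_form n w \<theta> x - c * L x" for x
    by (simp add: affine_form_def L_def w2_def \<theta>2_def algebra_simps sum_subtractf sum_distrib_left)
  have VB: "\<bar>V x\<bar> \<le> B" if "x \<in> cube n" for x
    using affine_form_sum_bound[OF that, of "\<lambda>i. real_of_int (v i)"] vB
    unfolding V_def affine_form_def by linarith
  let ?E = "{x \<in> cube n. sign (affine_form n w \<theta> x) \<noteq> sign (affine_form n (\<lambda>i. real_of_int (v' i)) \<tau>' x)}"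
  let ?E2 = "{x \<in> cube n. sign (affine_form n w2 \<theta>2 x) \<noteq> sign (V x)}"
  have sub: "x \<in> ?E2 \<and> L x = 0" if x: "x \<in> ?E" for x
  proof -
    have xc: "x \<in> cube n" using x by simp
    have "L x = 0"
    proof (rule ccontr)
      assume nz: "L x \<noteq> 0"
      note Lx = L[OF xc nz]
      have H0: "real_of_int H > 0" using H B by linarith
      have "real_of_int H * 1 \<le> real_of_int H * \<bar>L x\<bar>" using Lx H0 by (intro mult_left_mono) auto
      moreover have "\<bar>real_of_int H * L x\<bar> = real_of_int H * \<bar>L x\<bar>" using H0 by (simp add: abs_mult)
      ultimately have "B < \<bar>real_of_int H * L x\<bar>" using H(1) by linarith
      moreover have "real_of_int H * L x \<ge> 0 \<longleftrightarrow> L x \<ge> 0" using H0 by (simp add: zero_le_mult_iff)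
      ultimately have "sign (real_of_int H * L x + V x) = sign (L x)"
        using VB[OF xc] unfolding sign_def by argo
      then show False using x Lx comb by simp
    qed
    then show ?thesis using x comb[of x] w2[of x] by simp
  qed
  have w2j: "w2 j = 0" using j by (simp add: w2_def c)
  have vj: "v j = 0" using v j w2j by blast
  let ?fl = "\<lambda>x :: nat \<Rightarrow> real. x(j := - x j)"
  have fl: "?fl x \<in> ?E2 \<and> L (?fl x) \<noteq> 0" if x: "x \<in> ?E" for x
  proof -
    have xc: "x \<in> cube n" using x by simp
    have "affine_form n w2 \<theta>2 (?fl x) = affine_form n w2 \<theta>2 x" "V (?fl x) = V x"
      unfolding V_def using affine_form_flip[OF j(1)] w2j vj by simp_all
    moreover have "L (?fl x) = L x - 2 * real_of_int (l j) * x j"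
      unfolding L_def by (rule affine_form_flip[OF j(1)])
    ultimately show ?thesis
      using sub[OF x] flip_in_cube[OF xc j(1)] cube_cases[OF xc j(1)] j(2) by auto
  qed
  have fin: "finite ?E" "finite ?E2" by auto
  have inj: "inj_on ?fl ?E"
    by (rule inj_on_inverseI[where g = ?fl]) auto
  \<comment> \<open>\<open>L\<close> vanishes on \<open>?E\<close> and nowhere on its flipped copy,
    so two disjoint copies of \<open>?E\<close> fit into \<open>?E2\<close>.\<close>
  have "?E \<inter> ?fl ` ?E = {}" using sub fl by blast
  then have "card (?E \<union> ?fl ` ?E) = card ?E + card (?fl ` ?E)" using fin by (intro card_Un_disjoint) auto
  also have "card (?fl ` ?E) = card ?E" by (rule card_image[OF inj])
  finally have "2 * card ?E = card (?E \<union> ?fl ` ?E)" by linarith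
  also have "\<dots> \<le> card ?E2"
  proof (rule card_mono[OF fin(2)])
    show "?E \<union> ?fl ` ?E \<subseteq> ?E2" using sub fl by blast
  qed
  finally have "2 * real (card ?E) \<le> real (card ?E2)" by linarith
  also have "\<dots> \<le> \<delta> * 2 ^ n" using err unfolding V_def .
  finally have err': "real (card ?E) \<le> \<delta> / 2 * 2 ^ n" by simp
  show ?thesis
  proof (rule int_approxI[OF _ _ err'])
    fix i assume i: "i \<in> {1..n}" "w i = 0"
    \<comment> \<open>Then the remainder also has weight 0 at \<open>i\<close>, which forces
      \<open>v i = 0\<close>.\<close>
    then have "l i = 0" using supp by blast
    then show "v' i = 0" using i v[of i] by (simp add: v'_def w2_def)
  next
    have "(\<Sum>i=1..n. \<bar>real_of_int (v' i)\<bar>) \<le> (\<Sum>i=1..n. real_of_int H * \<bar>real_of_int (l i)\<bar> + \<bar>real_of_int (v i)\<bar>)"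
    proof (rule sum_mono)
      fix i
      have "\<bar>real_of_int (v' i)\<bar> \<le> \<bar>real_of_int H * real_of_int (l i)\<bar> + \<bar>real_of_int (v i)\<bar>"
        by (simp add: v'_def abs_triangle_ineq)
      then show "\<bar>real_of_int (v' i)\<bar> \<le> real_of_int H * \<bar>real_of_int (l i)\<bar> + \<bar>real_of_int (v i)\<bar>"
        using H B by (simp add: abs_mult)
    qed
    moreover have "\<bar>\<tau>'\<bar> \<le> real_of_int H * \<bar>real_of_int u\<bar> + \<bar>\<tau>\<bar>"
    proof -
      have "\<bar>\<tau>'\<bar> \<le> \<bar>real_of_int H * real_of_int u\<bar> + \<bar>\<tau>\<bar>" by (simp add: \<tau>'_def abs_triangle_ineq)
      then show ?thesis using H B by (simp add: abs_mult)
    qed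
    ultimately have "(\<Sum>i=1..n. \<bar>real_of_int (v' i)\<bar>) + \<bar>\<tau>'\<bar>
        \<le> real_of_int H * ((\<Sum>i=1..n. \<bar>real_of_int (l i)\<bar>) + \<bar>real_of_int u\<bar>)
          + ((\<Sum>i=1..n. \<bar>real_of_int (v i)\<bar>) + \<bar>\<tau>\<bar>)"
      by (simp add: sum.distrib sum_distrib_left distrib_left)
    also have "\<dots> \<le> (B + 1) * D + B"
    proof (intro add_mono mult_mono)
      show "0 \<le> (\<Sum>i=1..n. \<bar>real_of_int (l i)\<bar>) + \<bar>real_of_int u\<bar>" by (simp add: sum_nonneg)
    qed (use H bound vB B in auto)
    finally show "(\<Sum>i=1..n. \<bar>real_of_int (v' i)\<bar>) + \<bar>\<tau>'\<bar> \<le> (B + 1) * D + B" .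
  qed
qed

section \<open>Rounding cases and the induction on depth\<close>

lemma weight_sum_bound:
  assumes J: "J \<subseteq> {1..n}" "card J \<le> K" and A: "\<And>i. i \<in> {1..n} \<Longrightarrow> \<bar>w i\<bar> \<le> A" "A \<ge> 0"
    and s: "\<And>i. i \<in> {1..n} - J \<Longrightarrow> \<bar>w i\<bar> \<le> s" "s \<ge> 0"
  shows "(\<Sum>i=1..n. \<bar>w i\<bar>) \<le> real K * A + real n * s"
proof -
  have "(\<Sum>i=1..n. \<bar>w i\<bar>) = (\<Sum>i\<in>{1..n} - J. \<bar>w i\<bar>) + (\<Sum>i\<in>J. \<bar>w i\<bar>)"
    using J by (intro sum.subset_diff) auto
  also have "\<dots> \<le> real (card ({1..n} - J)) * s + real (card J) * A"
    using J A s by (intro add_mono sum_bounded_above) auto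
  also have "\<dots> \<le> real n * s + real K * A"
    using A s J card_mono[of "{1..n}" "{1..n} - J"] by (intro add_mono mult_right_mono) auto
  finally show ?thesis by simp
qed

text \<open>At most \<open>K\<close> weights exceed \<open>s\<close>, and even these are at most
  \<open>n * \<Lambda> * s\<close>. The scale therefore cancels, and the bound on the rounded form
  is independent of the weights.\<close>

lemma rounding_case:
  assumes n: "n \<ge> 1" and \<epsilon>: "\<epsilon> > 0" and s: "s > 0" and A: "0 \<le> A" "A \<le> s * (real n * \<Lambda>)"
    and J: "J \<subseteq> {1..n}" "card J \<le> K" and Amax: "\<And>i. i \<in> {1..n} \<Longrightarrow> \<bar>w i\<bar> \<le> A"
    and rest: "\<And>i. i \<in> {1..n} - J \<Longrightarrow> \<bar>w i\<bar> \<le> s"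
    and small: "real (card {x \<in> cube n. \<bar>affine_form n w \<theta> x\<bar> < s}) \<le> \<epsilon> * 2 ^ n"
    and B: "2 * (real K * \<Lambda> + 1) * real n * sqrt (real n / \<epsilon>) \<le> B" "B \<ge> 1"
  shows "int_approx n w \<theta> B (2 * \<epsilon>)"
proof (rule int_approx_rounding[OF n s \<epsilon> small _ B(2)])
  have "(\<Sum>i=1..n. \<bar>w i\<bar>) \<le> real K * A + real n * s"
    using J Amax A(1) rest s by (intro weight_sum_bound) auto
  also have "\<dots> \<le> real K * (s * (real n * \<Lambda>)) + real n * s" using A(2) by (intro add_mono mult_left_mono) auto
  also have "\<dots> = (real K * \<Lambda> + 1) * real n * s" by (simp add: algebra_simps)
  finally have "(\<Sum>i=1..n. \<bar>w i\<bar>) * (sqrt (real n / \<epsilon>) / s) \<le> (real K * \<Lambda> + 1) * real n * s * (sqrt (real n / \<epsilon>) / s)"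
    using \<epsilon> s by (intro mult_right_mono) auto
  also have "\<dots> = (real K * \<Lambda> + 1) * real n * sqrt (real n / \<epsilon>)" using s by simp
  finally show "2 * (\<Sum>i=1..n. \<bar>w i\<bar>) * (sqrt (real n / \<epsilon>) / s) \<le> B"
    using B(1) by (simp only: mult.assoc)
qed

text \<open>The scale \<open>s\<close> is the smallest of the \<open>K\<close> largest absolute
  weights. It serves as a lower bound on \<open>J\<close> for Littlewood-Offord and as an upper
  bound off \<open>J\<close> for the cost of rounding.\<close>

lemma largest_weights:
  fixes n K :: nat and w :: "nat \<Rightarrow> real"
  assumes "card {i \<in> {1..n}. \<bar>w i\<bar> \<ge> \<beta>} \<ge> K" "K > 0"
  obtains J s where "J \<subseteq> {1..n}" "card J = K" "s \<ge> \<beta>" "\<And>i. i \<in> J \<Longrightarrow> \<bar>w i\<bar> \<ge> s"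
    "\<And>i. i \<in> {1..n} - J \<Longrightarrow> \<bar>w i\<bar> \<le> s"
proof -
  have "K \<le> card {1..n}" by (rule order.trans[OF assms(1)], intro card_mono) auto
  then obtain J where J: "J \<subseteq> {1..n}" "card J = K" "\<And>l p. l \<in> J \<Longrightarrow> p \<in> {1..n} - J \<Longrightarrow> - \<bar>w l\<bar> \<le> - \<bar>w p\<bar>"
    using smallest_subset[of "{1..n}" K "\<lambda>i. - \<bar>w i\<bar>"] by auto
  have fin: "finite J" using J finite_subset by blast
  have ne: "J \<noteq> {}" using J assms(2) by auto
  define k where "k = arg_min_on (\<lambda>i. \<bar>w i\<bar>) J"
  have k: "k \<in> J" "\<And>i. i \<in> J \<Longrightarrow> \<bar>w k\<bar> \<le> \<bar>w i\<bar>"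
    unfolding k_def using arg_min_if_finite[OF fin ne] arg_min_least[OF fin ne] by auto
  have "\<bar>w k\<bar> \<ge> \<beta>"
  proof (rule ccontr)
    assume *: "\<not> \<bar>w k\<bar> \<ge> \<beta>"
    \<comment> \<open>Off \<open>J\<close> all weights are at most that of \<open>k\<close>, hence
      below \<open>\<beta>\<close>; this leaves at most \<open>K - 1\<close> large weights.\<close>
    have "{i \<in> {1..n}. \<bar>w i\<bar> \<ge> \<beta>} \<subseteq> J - {k}"
      using J(3)[OF k(1)] * by fastforce
    then have "card {i \<in> {1..n}. \<bar>w i\<bar> \<ge> \<beta>} \<le> card (J - {k})" using fin by (intro card_mono) auto
    also have "\<dots> < K" using k fin J(2) assms(2) by simp
    finally show False using assms(1) by simp
  qed
  then show thesis using that[of J "\<bar>w k\<bar>"] J k by auto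
qed

text \<open>Induction on the depth \<open>d\<close> for all forms at once. A rounding case ends the
  recursion with error \<open>2 * \<epsilon>\<close> and bound \<open>B\<close>; a clustered form
  costs a factor \<open>2 * D + 1\<close> in the bound and halves the error.\<close>

lemma int_approx_main:
  fixes n K m T :: nat and \<epsilon> :: real
  defines "T \<equiv> 4 * (K + 1)"
  defines "\<Lambda> \<equiv> 2 * real T ^ (3 * m + 1)"
  defines "D \<equiv> 3 * real (K + 1) * real T ^ (3 * m + 1)"
  defines "B \<equiv> 2 * (real K * \<Lambda> + 1) * real n * sqrt (real n / \<epsilon>)"
  assumes n: "n \<ge> 1" and \<epsilon>: "0 < \<epsilon>" "\<epsilon> < 1" and m: "m > 0" "1147 / (real m * sqrt (real m)) \<le> \<epsilon>"
    and K: "K > 0" "2 \<le> \<epsilon> * sqrt (real K)"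
  shows "int_approx n w \<theta> (B * (2 * D + 1) ^ d) (max (1 / 2 ^ d) (2 * \<epsilon>))"
proof -
  have T: "T \<ge> 4" by (simp add: T_def)
  have \<Lambda>: "\<Lambda> \<ge> 2" using T one_le_power[of "real T" "3 * m + 1"] by (simp add: \<Lambda>_def)
  have D: "D \<ge> 0" by (simp add: D_def)
  have B1: "B \<ge> 1"
  proof -
    have "sqrt (real n / \<epsilon>) \<ge> 1" using n \<epsilon> by (simp add: field_simps)
    moreover have "2 * (real K * \<Lambda> + 1) \<ge> 1" using \<Lambda> by simp
    ultimately show ?thesis
      unfolding B_def using n mult_mono[of 1 "2 * (real K * \<Lambda> + 1)" 1 "real n"]
        mult_mono[of 1 "2 * (real K * \<Lambda> + 1) * real n" 1 "sqrt (real n / \<epsilon>)"] by simp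
  qed
  have grow: "B * (2 * D + 1) ^ d \<ge> 1" for d
    using mult_mono[of 1 B 1 "(2 * D + 1) ^ d"] B1 D one_le_power[of "2 * D + 1" d] by simp
  have grow': "B \<le> B * (2 * D + 1) ^ d" for d
    using mult_left_mono[of 1 "(2 * D + 1) ^ d" B] B1 D one_le_power[of "2 * D + 1" d] by simp
  show ?thesis
  proof (induction d arbitrary: w \<theta>)
    case 0
    \<comment> \<open>At depth 0 the allowed error is the whole cube, so the zero form will
      do.\<close>
    have "int_approx n w \<theta> B 1"
    proof (rule int_approxI[where v = "\<lambda>_. 0" and \<tau> = 0])
      show "real (card {x \<in> cube n. sign (affine_form n w \<theta> x) \<noteq> sign (affine_form n (\<lambda>i. real_of_int 0) 0 x)}) \<le> 1 * 2 ^ n"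
        using card_mono[OF finite_cube Collect_restrict, of n "\<lambda>x. sign (affine_form n w \<theta> x) \<noteq> sign (affine_form n (\<lambda>i. real_of_int 0) 0 x)"]
        by (simp add: card_cube)
    qed (use B1 in auto)
    then show ?case by (auto elim: int_approx_mono)
  next
    case (Suc d)
    show ?case
    proof (cases "(\<forall>i\<in>{1..n}. w i = 0) \<or> \<bar>\<theta>\<bar> > (\<Sum>i=1..n. \<bar>w i\<bar>)")
      case True
      have "int_approx n w \<theta> (B * (2 * D + 1) ^ Suc d) 0"
      proof (cases "\<bar>\<theta>\<bar> > (\<Sum>i=1..n. \<bar>w i\<bar>)")
        case True
        then show ?thesis using int_approx_large_threshold grow by blast
      next
        case False
        then show ?thesis
          using True grow[of "Suc d"]
          by (intro int_approx_constant[where a = "sign (- \<theta>)"]) (auto simp: affine_form_def simp del: power_Suc)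
      qed
      then show ?thesis by (rule int_approx_mono) (use \<epsilon> in \<open>auto simp: max_def\<close>)
    next
      case False
      then have nz: "\<exists>i\<in>{1..n}. w i \<noteq> 0" and \<theta>: "\<bar>\<theta>\<bar> \<le> (\<Sum>i=1..n. \<bar>w i\<bar>)" by auto
      define A where "A = Max ((\<lambda>i. \<bar>w i\<bar>) ` {1..n})"
      have Amax: "\<bar>w i\<bar> \<le> A" if "i \<in> {1..n}" for i unfolding A_def using that by (intro Max_ge) auto
      have "A \<in> (\<lambda>i. \<bar>w i\<bar>) ` {1..n}" unfolding A_def using n by (intro Max_in) auto
      then obtain j where j: "j \<in> {1..n}" "\<bar>w j\<bar> = A" by auto
      have A: "A > 0" using nz Amax by fastforce
      define \<beta> where "\<beta> = A / (real n * \<Lambda>)"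
      have \<beta>: "\<beta> > 0" using A n \<Lambda> by (simp add: \<beta>_def)
      have A\<beta>: "A = \<beta> * (real n * \<Lambda>)" using n \<Lambda> by (simp add: \<beta>_def)
      let ?I = "{i \<in> {1..n}. \<bar>w i\<bar> \<ge> \<beta>}"
      have finish: "int_approx n w \<theta> (B * (2 * D + 1) ^ Suc d) (max (1 / 2 ^ Suc d) (2 * \<epsilon>))"
        if "int_approx n w \<theta> B (2 * \<epsilon>)"
        by (rule int_approx_mono[OF that grow']) simp
      consider (many) "card ?I \<ge> K"
        | (separated) S where "card ?I < K" "S \<subseteq> ?I" "card S = 3 * m"
            "\<And>i j. i \<in> S \<Longrightarrow> j \<in> S \<Longrightarrow> i \<noteq> j \<Longrightarrow> \<bar>\<bar>w i\<bar> - \<bar>w j\<bar>\<bar> \<ge> \<beta>"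
        | (clustered) "card ?I < K" "\<And>S. S \<subseteq> ?I \<Longrightarrow>
            (\<And>i j. i \<in> S \<Longrightarrow> j \<in> S \<Longrightarrow> i \<noteq> j \<Longrightarrow> \<bar>\<bar>w i\<bar> - \<bar>w j\<bar>\<bar> \<ge> \<beta>) \<Longrightarrow> card S \<le> 3 * m"
      proof (cases "card ?I \<ge> K")
        case False
        show thesis
        proof (cases "\<exists>S \<subseteq> ?I. card S > 3 * m \<and> (\<forall>i\<in>S. \<forall>j\<in>S. i \<noteq> j \<longrightarrow> \<bar>\<bar>w i\<bar> - \<bar>w j\<bar>\<bar> \<ge> \<beta>)")
          case True
          then obtain S where S_all: "S \<subseteq> ?I \<and> card S > 3 * m \<and>
              (\<forall>i\<in>S. \<forall>j\<in>S. i \<noteq> j \<longrightarrow> \<bar>\<bar>w i\<bar> - \<bar>w j\<bar>\<bar> \<ge> \<beta>)" by (rule exE)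
          have S: "S \<subseteq> ?I" "card S > 3 * m" using S_all by simp_all
          have S_sep: "\<bar>\<bar>w i\<bar> - \<bar>w j\<bar>\<bar> \<ge> \<beta>" if "i \<in> S" "j \<in> S" "i \<noteq> j" for i j
            using S_all that by simp
          obtain S' where S': "S' \<subseteq> S" "card S' = 3 * m"
            by (rule obtain_subset_with_card_n[OF less_imp_le[OF S(2)]])
          show thesis
          proof (rule separated)
            show "card ?I < K" using False by simp
            show "S' \<subseteq> ?I" using S'(1) S(1) by (rule order.trans)
            show "card S' = 3 * m" by (rule S'(2))
            show "\<beta> \<le> \<bar>\<bar>w i\<bar> - \<bar>w j\<bar>\<bar>" if "i \<in> S'" "j \<in> S'" "i \<noteq> j" for i j
              using S_sep[OF subsetD[OF S'(1) that(1)] subsetD[OF S'(1) that(2)] that(3)] .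
          qed
        next
          case none: False
          show thesis
          proof (rule clustered)
            fix S assume "S \<subseteq> ?I" "\<And>i j. i \<in> S \<Longrightarrow> j \<in> S \<Longrightarrow> i \<noteq> j \<Longrightarrow> \<bar>\<bar>w i\<bar> - \<bar>w j\<bar>\<bar> \<ge> \<beta>"
            then show "card S \<le> 3 * m" using none by (meson not_le)
          qed (use False in simp)
        qed
      qed (use many in simp)
      then show ?thesis
      proof cases
        case many
        obtain J s where J: "J \<subseteq> {1..n}" "card J = K" "s \<ge> \<beta>" "\<And>i. i \<in> J \<Longrightarrow> \<bar>w i\<bar> \<ge> s"
          "\<And>i. i \<in> {1..n} - J \<Longrightarrow> \<bar>w i\<bar> \<le> s"
          using largest_weights[OF many K(1)] by metis
        have s: "s > 0" using J \<beta> by linarith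
        have "real (card {x \<in> cube n. \<bar>affine_form n w \<theta> x\<bar> < s}) * real K \<le> 2 ^ (n + 1) * sqrt (real K)"
          using littlewood_offord[OF J(1) J(4) s] J(2) by simp
        also have "\<dots> = 2 * (2 ^ n * sqrt (real K))" by simp
        \<comment> \<open>The choice of \<open>K\<close> makes the Littlewood-Offord probability
          \<open>2 / sqrt K\<close> at most \<epsilon>.\<close>
        also have "\<dots> \<le> \<epsilon> * sqrt (real K) * (2 ^ n * sqrt (real K))" by (rule mult_right_mono[OF K(2)]) simp
        also have "\<dots> = \<epsilon> * 2 ^ n * (sqrt (real K) * sqrt (real K))" by (simp only: mult_ac)
        finally have "real (card {x \<in> cube n. \<bar>affine_form n w \<theta> x\<bar> < s}) * real K \<le> \<epsilon> * 2 ^ n * real K" by simp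
        then have small: "real (card {x \<in> cube n. \<bar>affine_form n w \<theta> x\<bar> < s}) \<le> \<epsilon> * 2 ^ n" using K(1) by simp
        have A_le: "A \<le> s * (real n * \<Lambda>)" unfolding A\<beta> using J(3) \<Lambda> by (intro mult_right_mono) auto
        show ?thesis
          by (rule finish, rule rounding_case[where K = K and \<Lambda> = \<Lambda>, OF n \<epsilon>(1) s _ A_le J(1) _ Amax J(5) small])
             (use A B1 J(2) in \<open>simp_all add: B_def\<close>)
      next
        case (separated S)
        have "real (card {x \<in> cube n. \<bar>affine_form n w \<theta> x\<bar> < \<beta>}) \<le> 2 ^ n * (1147 / (real m * sqrt (real m)))"
          using separated by (intro separated_small_ball[of S] \<beta> m) auto
        also have "\<dots> \<le> 2 ^ n * \<epsilon>" by (intro mult_left_mono m) simp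
        finally have small: "real (card {x \<in> cube n. \<bar>affine_form n w \<theta> x\<bar> < \<beta>}) \<le> \<epsilon> * 2 ^ n"
          by (simp add: mult.commute)
        have rest: "\<bar>w i\<bar> \<le> \<beta>" if "i \<in> {1..n} - ?I" for i using that by auto
        \<comment> \<open>Here the scale is \<open>\<beta>\<close> itself, and the exceptional set
          \<open>?I\<close> has fewer than \<open>K\<close> elements.\<close>
        show ?thesis
          by (rule finish, rule rounding_case[where J = ?I and K = K and \<Lambda> = \<Lambda>, OF n \<epsilon>(1) \<beta> _ _ _ _ Amax rest small])
             (use A A\<beta> B1 separated(1) in \<open>auto simp: B_def\<close>)
      next
        case clustered
        have cardI: "card ?I \<le> K" using clustered(1) by simp
        show ?thesis
        proof (rule small_integer_form[OF n A j Amax _ cardI _ \<theta>])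
          show "\<beta> = A / (real n * (2 * real (4 * (K + 1)) ^ (3 * m + 1)))"
            unfolding \<beta>_def \<Lambda>_def T_def ..
        next
          fix S assume "S \<subseteq> ?I" "\<And>i j. i \<in> S \<Longrightarrow> j \<in> S \<Longrightarrow> i \<noteq> j \<Longrightarrow> \<bar>\<bar>w i\<bar> - \<bar>w j\<bar>\<bar> \<ge> \<beta>"
          then show "card S \<le> 3 * m" by (rule clustered(2))
        next
          fix l :: "nat \<Rightarrow> int" and u :: int
          assume l: "\<And>i. i \<in> {1..n} \<Longrightarrow> w i = 0 \<Longrightarrow> l i = 0" "l j \<noteq> 0"
            "(\<Sum>i=1..n. \<bar>real_of_int (l i)\<bar>) + \<bar>real_of_int u\<bar>
              \<le> 3 * real (K + 1) * real (4 * (K + 1)) ^ (3 * m + 1)"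
            "\<And>x. x \<in> cube n \<Longrightarrow> affine_form n (\<lambda>i. real_of_int (l i)) (real_of_int u) x \<noteq> 0 \<Longrightarrow>
               \<bar>affine_form n (\<lambda>i. real_of_int (l i)) (real_of_int u) x\<bar> \<ge> 1 \<and>
               sign (affine_form n w \<theta> x) = sign (affine_form n (\<lambda>i. real_of_int (l i)) (real_of_int u) x)"
          define c where "c = w j / real_of_int (l j)"
          let ?B = "B * (2 * D + 1) ^ d"
          have "int_approx n w \<theta> ((?B + 1) * D + ?B) (max (1 / 2 ^ d) (2 * \<epsilon>) / 2)"
            by (rule int_approx_step[OF l(1) j(1) l(2) _ l(4) c_def Suc.IH])
               (use l(3) grow[of d] in \<open>simp_all add: D_def T_def\<close>)
          then show ?thesis
          proof (rule int_approx_mono)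
            \<comment> \<open>Replacing 1 by \<open>?B \<ge> 1\<close> turns the recursion for the
              bound into a geometric one.\<close>
            have "(?B + 1) * D + ?B \<le> (?B + ?B) * D + ?B"
              using grow[of d] D by (intro add_mono mult_right_mono) auto
            also have "\<dots> = B * (2 * D + 1) ^ Suc d" by (simp add: algebra_simps)
            finally show "(?B + 1) * D + ?B \<le> B * (2 * D + 1) ^ Suc d" .
            show "max (1 / 2 ^ d) (2 * \<epsilon>) / 2 \<le> max (1 / 2 ^ Suc d) (2 * \<epsilon>)"
              using \<epsilon> by (auto simp: max_def)
          qed
        qed
      qed
    qed
  qed
qed

section \<open>Choice of parameters\<close>

text \<open>Both the rounding bound and the cost of one level are \<open>2 powr O(x * y)\<close>:
  the base \<open>4 * (K + 1)\<close> is \<open>2 powr O(x)\<close> and its exponent is of order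
  \<open>y\<close>. The roughly \<open>x\<close> levels contribute another factor \<open>x\<close>,
  hence the exponent 2 of the logarithm.\<close>

lemma parameter_bound:
  fixes n :: nat and \<epsilon> :: real
  defines "x \<equiv> log 2 (2 / \<epsilon>)" and "y \<equiv> \<epsilon> powr (- (2 / 3))"
  assumes n: "n \<ge> 1" and \<epsilon>: "0 < \<epsilon>" "\<epsilon> < 1"
  obtains m K d :: nat where "m > 0" "1147 / (real m * sqrt (real m)) \<le> \<epsilon> / 2"
    "K > 0" "2 \<le> \<epsilon> / 2 * sqrt (real K)" "1 / 2 ^ d \<le> \<epsilon>"
    "2 * (real K * (2 * real (4 * (K + 1)) ^ (3 * m + 1)) + 1) * real n * sqrt (real n / (\<epsilon> / 2))
       * (2 * (3 * real (K + 1) * real (4 * (K + 1)) ^ (3 * m + 1)) + 1) ^ d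
       \<le> real n powr (3 / 2) * 2 powr (100000 * y * x powr 2)"
proof -
  have "log 2 2 \<le> x" unfolding x_def using \<epsilon> by (intro log_mono) (auto simp: field_simps)
  then have x: "x \<ge> 1" by simp
  have y: "y \<ge> 1" unfolding y_def using \<epsilon> by (subst powr_minus) (simp add: one_le_inverse_iff powr_le1)
  have px: "2 powr x = 2 / \<epsilon>" unfolding x_def using \<epsilon> by simp
  define z where "z = x * y"
  have z: "z \<ge> 1" "x \<le> z" using x y mult_mono[of 1 x 1 y] by (auto simp: z_def)
  have ysy: "y * sqrt y = 1 / \<epsilon>"
  proof -
    have "y * sqrt y = y powr 1 * y powr (1 / 2)" using y by (simp add: powr_half_sqrt)
    also have "\<dots> = \<epsilon> powr (- 1)" unfolding powr_add[symmetric] y_def powr_powr by simp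
    finally show ?thesis using \<epsilon> by (simp add: powr_minus divide_inverse)
  qed
  \<comment> \<open>Since \<open>y * sqrt y = 1 / \<epsilon>\<close>, the factor 2294 = 2 * 1147
    gives the separated bound for \<open>\<epsilon> / 2\<close>.\<close>
  define m where "m = nat \<lceil>2294 * y\<rceil>"
  have m: "2294 * y \<le> real m" "real m \<le> 2295 * y"
    using y unfolding m_def by linarith+
  \<comment> \<open>Chosen so that \<open>sqrt K \<ge> 4 / \<epsilon>\<close>.\<close>
  define K where "K = nat \<lceil>16 / \<epsilon>\<^sup>2\<rceil>"
  have e2: "1 / \<epsilon>\<^sup>2 \<ge> 1" using \<epsilon> by (simp add: power_le_one field_simps)
  have K: "16 / \<epsilon>\<^sup>2 \<le> real K" "real K \<le> 16 / \<epsilon>\<^sup>2 + 1"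
    using e2 unfolding K_def by linarith+
  \<comment> \<open>\<open>2 powr (x - 1)\<close> is \<open>1 / \<epsilon>\<close>, so this is
    enough halvings to reach \<epsilon>.\<close>
  define d where "d = nat \<lceil>x - 1\<rceil>"
  have d: "x - 1 \<le> real d" "real d \<le> x" using x unfolding d_def by linarith+
  show thesis
  proof (rule that[of m K d])
    show "m > 0" using m y by linarith
    have "sqrt y \<le> sqrt (real m)" using m y by simp
    then have "2294 * y * sqrt y \<le> real m * sqrt (real m)" using m y by (intro mult_mono) auto
    then have "2294 / \<epsilon> \<le> real m * sqrt (real m)" using ysy by (simp add: mult.assoc)
    then have "1147 / (real m * sqrt (real m)) \<le> 1147 / (2294 / \<epsilon>)" using \<epsilon>
      by (intro divide_left_mono mult_pos_pos) (auto simp: \<open>m > 0\<close>)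
    then show "1147 / (real m * sqrt (real m)) \<le> \<epsilon> / 2" by simp
    show "K > 0" using K e2 by linarith
    have "sqrt (16 / \<epsilon>\<^sup>2) \<le> sqrt (real K)" using K by simp
    then have "4 / \<epsilon> \<le> sqrt (real K)" using \<epsilon> by (simp add: real_sqrt_divide)
    then show "2 \<le> \<epsilon> / 2 * sqrt (real K)" using \<epsilon> by (simp add: field_simps)
    have "2 / \<epsilon> = 2 * 2 powr (x - 1)" unfolding px[symmetric] by (simp add: powr_diff)
    also have "\<dots> \<le> 2 * 2 powr real d" using d by simp
    finally show "1 / 2 ^ d \<le> \<epsilon>" using \<epsilon> by (simp add: powr_realpow field_simps)
  next
    define P where "P t = (2 :: real) powr t" for t
    have Pm: "s \<le> t \<Longrightarrow> P s \<le> P t" for s t by (simp add: P_def)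
    have Pa: "P s * P t = P (s + t)" for s t by (simp add: P_def powr_add)
    have P1: "s \<ge> 0 \<Longrightarrow> 1 \<le> P s" for s by (simp add: P_def ge_one_powr_ge_zero)
    have P2: "P 1 = 2" "P 2 = 4" "P 3 = 8" by (simp_all add: P_def)
    have Ppow: "P s ^ k = P (s * real k)" for s k by (simp add: P_def powr_power mult.commute)
    have P0: "P s > 0" for s by (simp add: P_def)
    have K1: "real (K + 1) \<le> P (3 + 2 * x)"
    proof -
      have "P (2 * x) = 4 / \<epsilon>\<^sup>2"
        using px Ppow[of x 2] by (simp add: P_def power_divide mult.commute)
      then have "P (3 + 2 * x) = 32 / \<epsilon>\<^sup>2" using Pa[of 3 "2 * x"] P2 by simp
      then show ?thesis using K e2 by simp
    qed
    define Tp where "Tp = real (4 * (K + 1)) ^ (3 * m + 1)"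
    have Tp: "Tp \<le> P (48202 * z)"
    proof -
      have "real (4 * (K + 1)) \<le> P 2 * P (3 + 2 * x)" using K1 P2 by simp
      also have "\<dots> \<le> P (7 * x)" unfolding Pa using x by (intro Pm) simp
      finally have "Tp \<le> P (7 * x) ^ (3 * m + 1)" unfolding Tp_def by (intro power_mono) auto
      also have "\<dots> = P (7 * x * real (3 * m + 1))" by (rule Ppow)
      \<comment> \<open>\<open>3 * m + 1 \<le> 6885 * y + 1 \<le> 6886 * y\<close>, and 7 * 6886 =
        48202.\<close>
      also have "\<dots> \<le> P (7 * x * (6886 * y))"
        using m x y by (intro Pm mult_left_mono) auto
      finally show ?thesis by (simp add: z_def mult_ac)
    qed
    have Tp0: "Tp \<ge> 0" by (simp add: Tp_def)
    have K5: "real (K + 1) \<le> P (5 * z)"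
      using K1 by (rule order_trans) (use z in \<open>intro Pm; simp\<close>)
    have first: "2 * (real K * (2 * Tp) + 1) \<le> P (48210 * z)"
    proof -
      have "real K * (2 * Tp) \<le> P (5 * z) * (P 1 * P (48202 * z))"
        using K5 Tp Tp0 P2 by (intro mult_mono) auto
      also have "\<dots> = P (1 + 48207 * z)" unfolding Pa by (simp add: algebra_simps)
      finally have "2 * (real K * (2 * Tp) + 1) \<le> 2 * (2 * P (1 + 48207 * z))"
        using P1[of "1 + 48207 * z"] z by simp
      also have "\<dots> = P 2 * P (1 + 48207 * z)" using P2 by simp
      also have "\<dots> \<le> P (48210 * z)" unfolding Pa using z by (intro Pm) simp
      finally show ?thesis .
    qed
    have second: "2 * (3 * real (K + 1) * Tp) + 1 \<le> P (48210 * z)"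
    proof -
      have "3 * real (K + 1) * Tp \<le> 3 * P (5 * z) * P (48202 * z)"
        using K5 Tp Tp0 P0[of "5 * z"] by (intro mult_mono) auto
      also have "\<dots> = 3 * P (48207 * z)" unfolding mult.assoc Pa by (simp add: algebra_simps)
      finally have "2 * (3 * real (K + 1) * Tp) + 1 \<le> 8 * P (48207 * z)"
        using P1[of "48207 * z"] z by simp
      also have "\<dots> = P 3 * P (48207 * z)" using P2 by simp
      also have "\<dots> \<le> P (48210 * z)" unfolding Pa using z by (intro Pm) simp
      finally show ?thesis .
    qed
    have "(2 * (3 * real (K + 1) * Tp) + 1) ^ d \<le> P (48210 * z) ^ d"
      using second Tp0 by (intro power_mono) auto
    also have "\<dots> = P (48210 * z * real d)" by (rule Ppow)
    also have "\<dots> \<le> P (48210 * z * x)" using d z by (intro Pm mult_left_mono) auto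
    finally have third: "(2 * (3 * real (K + 1) * Tp) + 1) ^ d \<le> P (48210 * z * x)" .
    have root: "sqrt (real n / (\<epsilon> / 2)) \<le> sqrt (real n) * P z"
    proof -
      have "sqrt (real n / (\<epsilon> / 2)) = sqrt (real n) * sqrt (P x)"
        using px by (simp add: P_def real_sqrt_mult[symmetric])
      also have "sqrt (P x) \<le> P x"
        using P1[of x] x by (simp add: sqrt_le_D real_le_lsqrt power2_eq_square mult_le_cancel_right1)
      also have "P x \<le> P z" using z by (intro Pm)
      finally show ?thesis by (simp add: mult_left_mono)
    qed
    have nn: "real n * sqrt (real n) = real n powr (3 / 2)"
      using n powr_add[of "real n" 1 "1 / 2"] by (simp add: powr_half_sqrt)
    have "2 * (real K * (2 * Tp) + 1) * real n * sqrt (real n / (\<epsilon> / 2)) * (2 * (3 * real (K + 1) * Tp) + 1) ^ d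
        \<le> P (48210 * z) * real n * (sqrt (real n) * P z) * P (48210 * z * x)"
      using first root third Tp0 P0 \<epsilon> by (intro mult_mono) (auto simp: less_imp_le)
    also have "\<dots> = real n powr (3 / 2) * (P (48210 * z) * P z * P (48210 * z * x))"
      unfolding nn[symmetric] by (simp add: mult_ac)
    also have "\<dots> \<le> real n powr (3 / 2) * P (100000 * y * x powr 2)"
    proof (intro mult_left_mono)
      have zx: "z \<le> z * x" using z x mult_left_mono[of 1 x z] by simp
      have "x powr 2 = x * x" using x by (simp add: powr_numeral power2_eq_square)
      then have "y * x powr 2 = z * x" by (simp add: z_def)
      then have e: "100000 * y * x powr 2 = 100000 * (z * x)" by (simp add: mult.assoc)
      \<comment> \<open>All three terms are multiples of at most
        \<open>z * x = y * x\<^sup>2\<close>; the coefficients total 96421.\<close>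
      have "48210 * z + z + 48210 * z * x \<le> 100000 * y * x powr 2"
        unfolding e using zx z(1) by (simp add: mult.assoc)
      then show "P (48210 * z) * P z * P (48210 * z * x) \<le> P (100000 * y * x powr 2)"
        unfolding Pa by (rule Pm)
    qed simp
    finally show "2 * (real K * (2 * real (4 * (K + 1)) ^ (3 * m + 1)) + 1) * real n * sqrt (real n / (\<epsilon> / 2))
       * (2 * (3 * real (K + 1) * real (4 * (K + 1)) ^ (3 * m + 1)) + 1) ^ d
       \<le> real n powr (3 / 2) * 2 powr (100000 * y * x powr 2)"
      unfolding Tp_def P_def .
  qed
qed

theorem theorem2:
  shows "\<exists>C c :: real. C > 0 \<and> c > 0 \<and>
    (\<forall>n::nat. \<forall>f :: (nat \<Rightarrow> real) \<Rightarrow> real. \<forall>\<epsilon>::real.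
      n \<ge> 1 \<longrightarrow> threshold_function n f \<longrightarrow> 0 < \<epsilon> \<longrightarrow> \<epsilon> < 1 \<longrightarrow>
      (\<exists>(w :: nat \<Rightarrow> int) (\<theta> :: real).
        measure_pmf.prob (pmf_of_set (cube n))
          {x. f x \<noteq> halfspace_sign n (\<lambda>i. real_of_int (w i)) \<theta> x} \<le> \<epsilon> \<and>
        (\<forall>i\<in>{1..n}. real_of_int \<bar>w i\<bar> \<le>
          real n powr (3 / 2) *
          2 powr (C * \<epsilon> powr (- (2 / 3)) * (log 2 (2 / \<epsilon>)) powr c))))"
proof (rule exI[of _ 100000], rule exI[of _ 2], intro conjI allI impI)
  fix n :: nat and f :: "(nat \<Rightarrow> real) \<Rightarrow> real" and \<epsilon> :: real
  assume n: "n \<ge> 1" and f: "threshold_function n f" and \<epsilon>: "0 < \<epsilon>" "\<epsilon> < 1"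
  let ?R = "real n powr (3 / 2) * 2 powr (100000 * \<epsilon> powr (- (2 / 3)) * (log 2 (2 / \<epsilon>)) powr 2)"
  obtain w \<theta> where w: "\<And>x. x \<in> cube n \<Longrightarrow> f x = halfspace_sign n w \<theta> x"
    using f unfolding threshold_function_def by blast
  obtain m K d :: nat where p: "m > 0" "1147 / (real m * sqrt (real m)) \<le> \<epsilon> / 2"
    "K > 0" "2 \<le> \<epsilon> / 2 * sqrt (real K)" "1 / 2 ^ d \<le> \<epsilon>"
    "2 * (real K * (2 * real (4 * (K + 1)) ^ (3 * m + 1)) + 1) * real n * sqrt (real n / (\<epsilon> / 2))
       * (2 * (3 * real (K + 1) * real (4 * (K + 1)) ^ (3 * m + 1)) + 1) ^ d \<le> ?R"
    by (rule parameter_bound[OF n \<epsilon>])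
  \<comment> \<open>The recursion runs with \<open>\<epsilon> / 2\<close> because rounding has error
    twice its parameter.\<close>
  have e: "0 < \<epsilon> / 2" "\<epsilon> / 2 < 1" using \<epsilon> by auto
  have "max (1 / 2 ^ d) (2 * (\<epsilon> / 2)) \<le> \<epsilon>" using p(5) by simp
  then have "int_approx n w \<theta> ?R \<epsilon>"
    using int_approx_mono[OF int_approx_main[OF n e p(1-4), of w \<theta> d] p(6)] by blast
  then obtain v \<tau> where vB: "(\<Sum>i=1..n. \<bar>real_of_int (v i)\<bar>) + \<bar>\<tau>\<bar> \<le> ?R"
    and err: "real (card {x \<in> cube n. sign (affine_form n w \<theta> x) \<noteq> sign (affine_form n (\<lambda>i. real_of_int (v i)) \<tau> x)})
       \<le> \<epsilon> * 2 ^ n"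
    unfolding int_approx_def by blast
  let ?g = "halfspace_sign n (\<lambda>i. real_of_int (v i)) \<tau>"
  have eq: "cube n \<inter> {x. f x \<noteq> ?g x}
      = {x \<in> cube n. sign (affine_form n w \<theta> x) \<noteq> sign (affine_form n (\<lambda>i. real_of_int (v i)) \<tau> x)}"
    using w by (auto simp: halfspace_sign_def affine_form_def)
  have "measure_pmf.prob (pmf_of_set (cube n)) {x. f x \<noteq> ?g x} = real (card (cube n \<inter> {x. f x \<noteq> ?g x})) / 2 ^ n"
    by (subst measure_pmf_of_set) (simp_all add: card_cube)
  also have "\<dots> \<le> \<epsilon>" unfolding eq using err by (simp add: field_simps)
  finally have prob: "measure_pmf.prob (pmf_of_set (cube n)) {x. f x \<noteq> ?g x} \<le> \<epsilon>" .
  have "real_of_int \<bar>v i\<bar> \<le> ?R" if i: "i \<in> {1..n}" for i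
  proof -
    have "real_of_int \<bar>v i\<bar> \<le> (\<Sum>i=1..n. \<bar>real_of_int (v i)\<bar>)"
      using member_le_sum[OF i, of "\<lambda>i. \<bar>real_of_int (v i)\<bar>"] by simp
    then show ?thesis using vB abs_ge_zero[of \<tau>] by linarith
  qed
  with prob show "\<exists>(w :: nat \<Rightarrow> int) (\<theta> :: real).
        measure_pmf.prob (pmf_of_set (cube n)) {x. f x \<noteq> halfspace_sign n (\<lambda>i. real_of_int (w i)) \<theta> x} \<le> \<epsilon> \<and>
        (\<forall>i\<in>{1..n}. real_of_int \<bar>w i\<bar> \<le> ?R)"
    by blast
qed simp_all

end
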